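(* Let $H\leq G$ be an inclusion of countable groups, let $\mathbf{X}=(X,\mu,T)$ be a $G$-space, and let $\beta:\mathbf{Y}=(Y,\nu,S)\to\mathbf{X}^{\upharpoonright H}$ be an extension of $H$-spaces. Then there is an extension of $G$-spaces $\pi:\widetilde{\mathbf{X}}\to\mathbf{X}$ and a factor map of $H$-spaces $\alpha:\widetilde{\mathbf{X}}^{\upharpoonright H}\to\mathbf{Y}$ such that $\pi=\beta\circ\alpha$; that is, the triangle of $H$-spaces formed by $\pi:\widetilde{\mathbf{X}}^{\upharpoonright H}\to\mathbf{X}^{\upharpoonright H}$, $\alpha:\widetilde{\mathbf{X}}^{\upharpoonright H}\to\mathbf{Y}$ and $\beta:\mathbf{Y}\to\mathbf{X}^{\upharpoonright H}$ commutes.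
   Context: For a countable group $G$, a $G$-space is a triple $(X,\mu,T)$ consisting of a standard Borel probability space $(X,\mu)$ and an action $T:G\curvearrowright X$ by measurable $\mu$-preserving transformations. A factor map from $(X,\mu,T)$ to $(Y,\nu,S)$ is a measurable map $\pi:X\to Y$ with $\pi_*\mu=\nu$ and $S^g\circ\pi=\pi\circ T^g$ $\mu$-a.e. for all $g\in G$; it is also called a $G$-extension (extension of $G$-spaces), and $(X,\mu,T)$ is then an extension of $(Y,\nu,S)$. For $H\le G$ the $H$-subaction $\mathbf{X}^{\upharpoonright H}$ is the $H$-space $(X,\mu,(T^h)_{h\in H})$. Equalities of maps are understood almost everywhere. *)

theory Defs
  imports "HOL-Probability.Probability" "HOL-Algebra.Group_Action"
begin

definition standard_borel :: "'a measure \<Rightarrow> bool" where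
  "standard_borel M \<longleftrightarrow>
     (\<exists>\<tau>. completely_metrizable_space \<tau> \<and> second_countable \<tau> \<and> topspace \<tau> = space M \<and>
          sets M = sigma_sets (space M) {U. openin \<tau> U})"

text \<open>
  The action \<open>T\<close> is a genuine (everywhere defined) action on \<open>space M\<close>.  As \<^const>\<open>group_action\<close>
  is a homomorphism into \<^const>\<open>BijGroup\<close>, each \<open>T g\<close> is normalised to be \<open>undefined\<close> outside
  \<open>space M\<close>.  Only the values \<open>T g\<close> with \<open>g \<in> carrier G\<close> matter, here and in \<open>factor_map\<close>, so
  for a subgroup \<open>H\<close> of \<open>G\<close> the \<open>H\<close>-subaction of \<open>(M, T)\<close> is again \<open>(M, T)\<close>, regarded over the
  group \<open>G\<lparr>carrier := H\<rparr>\<close>.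
\<close>

definition G_space :: "('g, 'm) monoid_scheme \<Rightarrow> 'a measure \<Rightarrow> ('g \<Rightarrow> 'a \<Rightarrow> 'a) \<Rightarrow> bool" where
  "G_space G M T \<longleftrightarrow>
     prob_space M \<and> standard_borel M \<and> group_action G (space M) T \<and>
     (\<forall>g\<in>carrier G. T g \<in> measurable M M \<and> distr M M (T g) = M)"

definition factor_map ::
  "('g, 'm) monoid_scheme \<Rightarrow> 'a measure \<Rightarrow> ('g \<Rightarrow> 'a \<Rightarrow> 'a) \<Rightarrow>
   'b measure \<Rightarrow> ('g \<Rightarrow> 'b \<Rightarrow> 'b) \<Rightarrow> ('a \<Rightarrow> 'b) \<Rightarrow> bool" where
  "factor_map G M T N S \<pi> \<longleftrightarrow>
     G_space G M T \<and> G_space G N S \<and>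
     \<pi> \<in> measurable M N \<and> distr M N \<pi> = N \<and>
     (\<forall>g\<in>carrier G. AE x in M. S g (\<pi> x) = \<pi> (T g x))"

text \<open>
  An existence statement for \<open>G\<close>-spaces must fix the type of the points of the new space.  For an
  extension of \<open>(X, T)\<close> through an \<open>H\<close>-space \<open>Y\<close>, the type \<open>'g \<Rightarrow> 'y\<close> (with \<open>'g\<close>, \<open>'y\<close> the types
  of the elements of \<open>G\<close> and the points of \<open>Y\<close>) loses no generality: given \<open>(Z, R)\<close>, \<open>\<pi>\<close>, \<open>\<alpha>\<close> over
  any type with \<open>\<pi> = \<beta> \<circ> \<alpha>\<close> almost everywhere, the map sending \<open>z\<close> to the family
  \<open>\<lambda>g\<in>carrier G. \<alpha> (R g z)\<close> pushes \<open>Z\<close> forward to a shift-invariant measure on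
  \<open>\<Pi>\<^sub>E g\<in>carrier G. space Y\<close>, and evaluation at the unit and its composition with \<open>\<beta>\<close> take the
  roles of \<open>\<alpha>\<close> and \<open>\<pi>\<close>.
\<close>

end

theory Submission
  imports Defs
begin

text \<open>
  Sample a point \<open>x\<close> of \<open>X\<close> and then, conditionally independently for the right cosets \<open>c\<close> of \<open>H\<close>,
  a point of the fibre of \<open>\<beta>\<close> over \<open>T (r c) x\<close>, where \<open>r c \<in> c\<close> is a representative. Transporting
  these points along \<open>c\<close> by the action of \<open>H\<close> gives a random family in \<open>Y\<close> indexed by \<open>G\<close>. The
  conditional laws of \<open>Y\<close> over \<open>X\<close> are \<open>H\<close>-equivariant almost everywhere, so the law of the family does
  not depend on \<open>r\<close>; as a shift by \<open>g\<close> replaces \<open>x\<close> by \<open>T g x\<close>, permutes the cosets and changes \<open>r\<close>,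
  the law is shift-invariant. The extension is the shift with this law, \<open>\<alpha>\<close> is evaluation at the
  unit, and \<open>\<pi> = \<beta> \<circ> \<alpha>\<close>.

  Disintegration of measures is replaced by a transfer function: a measurable \<open>f\<close> such that, for
  independent \<open>x\<close> and uniform \<open>u\<close>, the pair \<open>(x, f (x, u))\<close> has the law of \<open>(\<beta> y, y)\<close>. It is a conditional
  quantile function, after \<open>Y\<close> has been coded by real numbers.
\<close>

section \<open>Standard Borel spaces\<close>

text \<open>All digits are 0 or 1, so every tail \<open>s m\<close> is at most 1/3. Hence the
  integer part of \<open>4 ^ Suc m * s 0\<close> ends in the base-4 digit \<open>b m\<close>, and
  its parity recovers that digit. In base 2 a tail could reach 1 and carry over.\<close>

lemma digit_base4:
  fixes b :: "nat \<Rightarrow> bool"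
  defines "s \<equiv> (\<lambda>m. \<Sum>n. of_bool (b (n + m)) / (4::real) ^ Suc n)"
  shows "odd \<lfloor>4 ^ Suc m * s 0\<rfloor> \<longleftrightarrow> b m" and "0 \<le> s m" and "s m < 1"
proof -
  have geo: "(\<lambda>n. 1 / (4::real) ^ Suc n) sums (1/3)"
    using sums_mult[OF geometric_sums[of "1/4::real"], of "1/4"] by (simp add: field_simps power_divide)
  have sm: "summable (\<lambda>n. of_bool (b (n + m)) / (4::real) ^ Suc n)" for m
    by (rule summable_comparison_test[OF _ sums_summable[OF geo]]) (auto simp: of_bool_def)
  have s0: "0 \<le> s m" for m
    unfolding s_def by (rule suminf_nonneg[OF sm]) auto
  have "s m \<le> 1/3" for m
    unfolding s_def sums_unique[OF geo]
    by (rule suminf_le[OF _ sm sums_summable[OF geo]]) (auto simp: of_bool_def)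
  then have s1: "s m < 1" for m
    by (rule le_less_trans) simp
  have step: "4 * s m = of_bool (b m) + s (Suc m)" for m
  proof -
    have "s m = of_bool (b m) / 4 + (\<Sum>n. of_bool (b (Suc n + m)) / (4::real) ^ Suc (Suc n))"
      unfolding s_def using suminf_split_head[OF sm[of m]] by simp
    also have "(\<Sum>n. of_bool (b (Suc n + m)) / (4::real) ^ Suc (Suc n)) = s (Suc m) / 4"
      unfolding s_def using suminf_divide[OF sm[of "Suc m"], of 4] by (simp add: mult.commute)
    finally show ?thesis by simp
  qed
  have "\<exists>i::int. 4 ^ m * s 0 = of_int i + s m"
  proof (induction m)
    case (Suc m)
    then obtain i :: int where "4 ^ m * s 0 = of_int i + s m" by blast
    then have "4 ^ Suc m * s 0 = 4 * of_int i + 4 * s m" by simp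
    then have "4 ^ Suc m * s 0 = of_int (4 * i + of_bool (b m)) + s (Suc m)"
      using step[of m] by simp
    then show ?case by blast
  qed (auto intro: exI[of _ 0])
  then obtain i :: int where "4 ^ m * s 0 = of_int i + s m" by blast
  then have "4 ^ Suc m * s 0 = 4 * of_int i + 4 * s m" by simp
  then have "4 ^ Suc m * s 0 = of_int (4 * i + of_bool (b m)) + s (Suc m)"
    using step[of m] by simp
  then have "\<lfloor>4 ^ Suc m * s 0\<rfloor> = 4 * i + of_bool (b m)"
    using s0[of "Suc m"] s1[of "Suc m"] by linarith
  then show "odd \<lfloor>4 ^ Suc m * s 0\<rfloor> \<longleftrightarrow> b m" by simp
  show "0 \<le> s m" "s m < 1" by (fact s0 s1)+
qed

text \<open>A countable base of a T1 topology separates points, so \<open>f\<close> and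
  \<open>g\<close> differ at \<open>x\<close> exactly when some base set contains only one of the
  two values. Equations thus become measurable conditions, as is required to carry almost everywhere
  identities through image measures.\<close>

lemma measurable_eq_standard_borel:
  assumes "standard_borel N" and f: "f \<in> measurable M N" and g: "g \<in> measurable M N"
  shows "{x \<in> space M. f x = g x} \<in> sets M"
proof -
  obtain \<tau> where t: "completely_metrizable_space \<tau>" "second_countable \<tau>" "topspace \<tau> = space N"
    "sets N = sigma_sets (space N) {U. openin \<tau> U}"
    using assms(1) unfolding standard_borel_def by blast
  obtain \<B> where B: "countable \<B>" "\<And>V. V \<in> \<B> \<Longrightarrow> openin \<tau> V"
    "\<And>U x. openin \<tau> U \<Longrightarrow> x \<in> U \<Longrightarrow> \<exists>V\<in>\<B>. x \<in> V \<and> V \<subseteq> U"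
    using t(2) unfolding second_countable_def by metis
  have Bs [measurable]: "V \<in> sets N" if "V \<in> \<B>" for V
    using B(2)[OF that] t(4) by (simp add: sigma_sets.Basic)
  have sep: "a = b" if ab: "a \<in> space N" "b \<in> space N" and eq: "\<forall>V\<in>\<B>. a \<in> V \<longleftrightarrow> b \<in> V" for a b
  proof (rule ccontr)
    assume "a \<noteq> b"
    moreover have "t1_space \<tau>"
      using t(1) completely_metrizable_imp_metrizable_space metrizable_imp_t1_space by blast
    ultimately obtain U where "openin \<tau> U" "a \<in> U" "b \<notin> U"
      using ab t(3) unfolding t1_space_def by metis
    then show False using B(3) eq by blast
  qed
  have "{x \<in> space M. f x = g x} =
      space M - (\<Union>V\<in>\<B>. {x \<in> space M. f x \<in> V \<longleftrightarrow> g x \<notin> V})"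
    using sep measurable_space[OF f] measurable_space[OF g] by auto
  also have "\<dots> \<in> sets M"
    using f g by (intro sets.Diff sets.countable_UN' B(1)) auto
  finally show ?thesis .
qed

text \<open>
  The digits of \<open>\<phi> y\<close> in base 4 record the membership of \<open>y\<close> in the balls around a dense sequence;
  as only the digits 0 and 1 occur, they can be read off again. With a
  measurable left inverse at hand, it does not matter whether the image of \<open>\<phi>\<close> is Borel.
\<close>

lemma standard_borel_embed_real:
  assumes "standard_borel N" and "space N \<noteq> {}"
  obtains \<phi> :: "'a \<Rightarrow> real" and \<psi> where "\<phi> \<in> borel_measurable N" "\<psi> \<in> measurable borel N"
    "\<And>y. y \<in> space N \<Longrightarrow> 0 \<le> \<phi> y \<and> \<phi> y < 1 \<and> \<psi> (\<phi> y) = y"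
proof -
  obtain \<tau> where t: "completely_metrizable_space \<tau>" "second_countable \<tau>" "topspace \<tau> = space N"
    "sets N = sigma_sets (space N) {U. openin \<tau> U}"
    using assms(1) unfolding standard_borel_def by blast
  obtain M' d where "Metric_space M' d" and "Metric_space.mcomplete M' d"
    and teq: "\<tau> = Metric_space.mtopology M' d"
    using t(1) unfolding completely_metrizable_space_def by blast
  then interpret Metric_space M' d by blast
  have mc: mcomplete by fact
  have M': "M' = space N" using t(3) teq by simp
  obtain C where C: "countable C" "C \<subseteq> M'" "mtopology closure_of C = M'"
    using second_countable_imp_separable_space[OF t(2)] unfolding separable_space_def teq by auto
  have "C \<noteq> {}" using C(3) assms(2) M' by auto
  define e where "e = from_nat_into C"
  have eM [simp]: "e k \<in> M'" for k
    using from_nat_into[OF \<open>C \<noteq> {}\<close>] C(2) by (auto simp: e_def)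
  have dense: "\<exists>k. d (e k) y < r" if "y \<in> M'" "r > 0" for y r
  proof -
    have "y \<in> mtopology closure_of C" using that C(3) by simp
    then obtain z where z: "z \<in> C" "z \<in> mball y r" using \<open>r > 0\<close> unfolding metric_closure_of by blast
    then obtain k where "e k = z" unfolding e_def using C(1) by (metis from_nat_into_to_nat_on)
    then show ?thesis using z commute by auto
  qed
  have ball_sets [measurable]: "mball y r \<in> sets N" for y r
    using t(4) teq by (simp add: sigma_sets.Basic)
  \<comment> \<open>The pairing function lists all balls of radius 1/(n+1) around the points of the
    dense sequence; digit \<open>m\<close> of a code refers to the \<open>m\<close>-th ball.\<close>
  define B where "B m = (case prod_decode m of (n, k) \<Rightarrow> mball (e k) (1 / real (Suc n)))" for m
  have B_sets [measurable]: "B m \<in> sets N" for m by (simp add: B_def split: prod.split)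
  define \<phi> where "\<phi> y = (\<Sum>n. of_bool (y \<in> B n) / (4::real) ^ Suc n)" for y
  define bit where "bit m r \<longleftrightarrow> odd \<lfloor>4 ^ Suc m * r\<rfloor>" for m and r :: real
  have bit_meas [measurable]: "Measurable.pred borel (bit m)" for m
    unfolding bit_def by measurable
  have bit_phi: "bit m (\<phi> y) \<longleftrightarrow> y \<in> B m" for m y
    using digit_base4(1)[of m "\<lambda>n. y \<in> B n"] by (simp add: \<phi>_def bit_def)
  have phi_bounds: "0 \<le> \<phi> y" "\<phi> y < 1" for y
    using digit_base4(2,3)[where m = 0 and b = "\<lambda>n. y \<in> B n"] by (simp_all add: \<phi>_def)
  have phi_meas: "\<phi> \<in> borel_measurable N"
    unfolding \<phi>_def by measurable
  \<comment> \<open>Decoding: the first centre whose ball of radius 1/(n+1) is marked in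
    \<open>r\<close>. When \<open>r\<close> is the code of \<open>y\<close>, the point
    \<open>e (K n r)\<close> is within 1/(n+1) of \<open>y\<close>.\<close>
  define K where "K n r = (LEAST k. bit (prod_encode (n, k)) r)" for n r
  have K_meas [measurable]: "K n \<in> measurable borel (count_space UNIV)" for n
    unfolding K_def by measurable
  define \<sigma> where "\<sigma> r n = e (K n r)" for r n
  have dist_meas [measurable]: "(\<lambda>r. d (\<sigma> r n) y) \<in> borel_measurable borel" for n y
    unfolding \<sigma>_def by (rule measurable_compose[OF K_meas]) simp
  have dist2_meas [measurable]: "(\<lambda>r. d (\<sigma> r n) (\<sigma> r n')) \<in> borel_measurable borel" for n n'
    unfolding \<sigma>_def
    using measurable_compose[OF measurable_Pair[OF K_meas[of n] K_meas[of n']], of "\<lambda>(i, j). d (e i) (e j)" borel]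
    by (simp add: pair_measure_countable)
  \<comment> \<open>Countable quantifiers over measurable distances express the Cauchy property of
    the decoded sequence, so it is a Borel condition on \<open>r\<close>.\<close>
  define cau where "cau r \<longleftrightarrow> (\<forall>j. \<exists>N. \<forall>n\<ge>N. \<forall>n'\<ge>N. d (\<sigma> r n) (\<sigma> r n') < 1 / real (Suc j))" for r
  have cau_meas [measurable]: "Measurable.pred borel cau"
    unfolding cau_def by measurable
  have cau: "cau r \<longleftrightarrow> MCauchy (\<sigma> r)" for r
  proof
    assume c: "cau r"
    show "MCauchy (\<sigma> r)" unfolding MCauchy_def
    proof (intro conjI allI impI)
      show "range (\<sigma> r) \<subseteq> M'" by (auto simp: \<sigma>_def)
      fix \<epsilon> :: real assume "\<epsilon> > 0"
      then obtain j where j: "1 / real (Suc j) < \<epsilon>" using nat_approx_posE by blast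
      obtain N where N: "\<forall>n\<ge>N. \<forall>n'\<ge>N. d (\<sigma> r n) (\<sigma> r n') < 1 / real (Suc j)"
        using c unfolding cau_def by blast
      then show "\<exists>N. \<forall>n n'. N \<le> n \<longrightarrow> N \<le> n' \<longrightarrow> d (\<sigma> r n) (\<sigma> r n') < \<epsilon>"
        using j by (meson less_trans)
    qed
  next
    assume "MCauchy (\<sigma> r)"
    then show "cau r" unfolding MCauchy_def cau_def by (metis zero_less_divide_1_iff of_nat_0_less_iff zero_less_Suc)
  qed
  \<comment> \<open>Completeness supplies the limit. A real that decodes to no Cauchy sequence is
    sent to \<open>e 0\<close>, which makes \<open>\<psi>\<close> total with values in the
    space.\<close>
  define \<psi> where "\<psi> r = (if cau r then SOME x. limitin mtopology (\<sigma> r) x sequentially else e 0)" for r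
  have psi_lim: "limitin mtopology (\<sigma> r) (\<psi> r) sequentially" if "cau r" for r
    using that mc someI_ex[of "\<lambda>x. limitin mtopology (\<sigma> r) x sequentially"]
    unfolding \<psi>_def mcomplete_def cau by simp
  have psi_M: "\<psi> r \<in> M'" for r
    using psi_lim[of r] limitin_mspace by (cases "cau r") (auto simp: \<psi>_def)
  \<comment> \<open>The limit is selected by choice, but its distance to a fixed point is a limit of
    measurable functions. Measurability of \<open>\<psi>\<close> is derived from these
    distances.\<close>
  have dpsi: "d (\<psi> r) y = (if cau r then lim (\<lambda>n. d (\<sigma> r n) y) else d (e 0) y)" if y: "y \<in> M'" for r y
  proof (cases "cau r")
    case True
    have "(\<lambda>n. d (\<sigma> r n) (\<psi> r)) \<longlonglongrightarrow> 0"
      using psi_lim[OF True] by (simp add: limitin_metric_dist_null)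
    moreover have "norm (d (\<sigma> r n) y - d (\<psi> r) y) \<le> d (\<sigma> r n) (\<psi> r)" for n
      using triangle[of "\<sigma> r n" "\<psi> r" y] triangle[of "\<psi> r" "\<sigma> r n" y] y psi_M[of r] commute[of "\<sigma> r n" "\<psi> r"]
      by (simp add: \<sigma>_def abs_le_iff)
    ultimately have "(\<lambda>n. d (\<sigma> r n) y - d (\<psi> r) y) \<longlonglongrightarrow> 0"
      using Lim_null_comparison[of "\<lambda>n. d (\<sigma> r n) y - d (\<psi> r) y" "\<lambda>n. d (\<sigma> r n) (\<psi> r)" sequentially]
      by simp
    then have "(\<lambda>n. d (\<sigma> r n) y) \<longlonglongrightarrow> d (\<psi> r) y"
      by (rule LIM_zero_cancel)
    then show ?thesis using True by (simp add: limI)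
  qed (simp add: \<psi>_def)
  have dpsi_meas [measurable]: "(\<lambda>r. d (\<psi> r) y) \<in> borel_measurable borel" if "y \<in> M'" for y
    unfolding dpsi[OF that] by measurable
  have "\<psi> \<in> measurable borel N"
  proof (rule measurable_sigma_sets[OF t(4)])
    show "{U. openin \<tau> U} \<subseteq> Pow (space N)" using t(3) openin_subset by blast
    show "\<psi> \<in> space borel \<rightarrow> space N" using psi_M M' by auto
    fix U assume "U \<in> {U. openin \<tau> U}"
    then have U: "openin mtopology U" using teq by simp
    \<comment> \<open>An open set is the union of the countably many balls with centres
      \<open>e k\<close> and radii 1/(j+1) that it contains, so its preimage is expressed by the
      distances \<open>d (\<psi> r) (e k)\<close>.\<close>
    have "\<exists>k j. mball (e k) (1 / real (Suc j)) \<subseteq> U \<and> x \<in> mball (e k) (1 / real (Suc j))" if x: "x \<in> U" for x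
    proof -
      have xM: "x \<in> M'" using U x openin_mtopology by blast
      obtain r where r: "r > 0" "mball x r \<subseteq> U" using U x unfolding openin_mtopology by blast
      obtain j where j: "1 / real (Suc j) < r / 2" using r nat_approx_posE[of "r/2"] by auto
      obtain k where k: "d (e k) x < 1 / real (Suc j)" using dense[OF xM, of "1 / real (Suc j)"] by auto
      have "mball (e k) (1 / real (Suc j)) \<subseteq> mball x r"
      proof
        fix z assume "z \<in> mball (e k) (1 / real (Suc j))"
        then have "z \<in> M'" "d (e k) z < 1 / real (Suc j)" by auto
        then show "z \<in> mball x r"
          using triangle[of x "e k" z] commute[of x "e k"] k j xM by auto
      qed
      then show ?thesis using k r xM by auto
    qed
    then have "\<psi> -` U \<inter> space borel = {r. \<exists>k j. mball (e k) (1 / real (Suc j)) \<subseteq> U \<and> d (\<psi> r) (e k) < 1 / real (Suc j)}"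
      using psi_M commute by (fastforce simp: subset_eq)
    also have "\<dots> \<in> sets borel" using dpsi_meas[OF eM] by measurable
    finally show "\<psi> -` U \<inter> space borel \<in> sets borel" .
  qed
  moreover have "\<psi> (\<phi> y) = y" if "y \<in> space N" for y
  proof -
    have yM: "y \<in> M'" using that M' by simp
    have near: "d (\<sigma> (\<phi> y) n) y < 1 / real (Suc n)" for n
    proof -
      obtain k where "d (e k) y < 1 / real (Suc n)" using dense[OF yM, of "1 / real (Suc n)"] by auto
      then have "bit (prod_encode (n, k)) (\<phi> y)" using yM by (simp add: bit_phi B_def)
      then have "bit (prod_encode (n, K n (\<phi> y))) (\<phi> y)" unfolding K_def by (rule LeastI)
      then show ?thesis by (simp add: bit_phi B_def \<sigma>_def)
    qed
    have "(\<lambda>n. d (\<sigma> (\<phi> y) n) y) \<longlonglongrightarrow> 0"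
      by (rule tendsto_sandwich[OF _ _ tendsto_const LIMSEQ_Suc[OF lim_1_over_n]])
        (auto intro: always_eventually less_imp_le[OF near] simp del: of_nat_Suc)
    then have lim: "limitin mtopology (\<sigma> (\<phi> y)) y sequentially"
      using yM by (simp add: limitin_metric_dist_null \<sigma>_def)
    then have "cau (\<phi> y)"
      unfolding cau by (intro convergent_imp_MCauchy) (auto simp: \<sigma>_def)
    then show ?thesis
      using limitin_metric_unique[OF psi_lim lim] by simp
  qed
  ultimately show ?thesis using that[OF phi_meas] phi_bounds by blast
qed

text \<open>The product topology over a countable index set is completely metrizable. Boxes that
  restrict finitely many coordinates to base sets form a countable base, so each open set is a
  countable union of measurable boxes; conversely the projections are continuous. Hence the Borel
  sets are those of the product sigma-algebra.\<close>

lemma standard_borel_PiM: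
  assumes I: "countable I" and M: "\<And>i. i \<in> I \<Longrightarrow> standard_borel (M i)"
  shows "standard_borel (PiM I M)"
proof -
  have "\<exists>\<tau>. completely_metrizable_space \<tau> \<and> second_countable \<tau> \<and> topspace \<tau> = space (M i) \<and>
          sets (M i) = sigma_sets (space (M i)) {U. openin \<tau> U}" if "i \<in> I" for i
    using M[OF that] unfolding standard_borel_def .
  then obtain \<tau> where t: "\<And>i. i \<in> I \<Longrightarrow> completely_metrizable_space (\<tau> i)"
    "\<And>i. i \<in> I \<Longrightarrow> second_countable (\<tau> i)" "\<And>i. i \<in> I \<Longrightarrow> topspace (\<tau> i) = space (M i)"
    "\<And>i. i \<in> I \<Longrightarrow> sets (M i) = sigma_sets (space (M i)) {U. openin (\<tau> i) U}"
    by metis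
  let ?P = "product_topology \<tau> I"
  have top: "topspace ?P = space (PiM I M)"
    using t(3) by (auto simp: space_PiM topspace_product_topology cong: PiE_cong)
  have "\<exists>\<B>. countable \<B> \<and> (\<forall>V\<in>\<B>. openin (\<tau> i) V) \<and>
      (\<forall>U x. openin (\<tau> i) U \<and> x \<in> U \<longrightarrow> (\<exists>V\<in>\<B>. x \<in> V \<and> V \<subseteq> U))" if "i \<in> I" for i
    using t(2)[OF that] unfolding second_countable_def .
  then obtain B where B: "\<And>i. i \<in> I \<Longrightarrow> countable (B i)" "\<And>i V. i \<in> I \<Longrightarrow> V \<in> B i \<Longrightarrow> openin (\<tau> i) V"
    "\<And>i U x. i \<in> I \<Longrightarrow> openin (\<tau> i) U \<Longrightarrow> x \<in> U \<Longrightarrow> \<exists>V\<in>B i. x \<in> V \<and> V \<subseteq> U"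
    by metis
  define box where "box J A = (\<Pi>\<^sub>E i\<in>I. if i \<in> J then A i else topspace (\<tau> i))" for J and A :: "'a \<Rightarrow> 'b set"
  \<comment> \<open>The choices \<open>A\<close> of base sets are taken extensional on the finite
    set \<open>J\<close>, so that only countably many pairs occur.\<close>
  define \<B> where "\<B> = (\<lambda>(J, A). box J A) ` (SIGMA J : {J. finite J \<and> J \<subseteq> I}. PiE J B)"
  have cB: "countable \<B>"
    unfolding \<B>_def using B(1) I
    by (intro countable_image countable_SIGMA countable_Collect_finite_subset countable_PiE) auto
  have oB: "openin ?P V" if "V \<in> \<B>" for V
  proof -
    obtain J A where JA: "finite J" "J \<subseteq> I" "A \<in> PiE J B" "V = box J A"
      using \<open>V \<in> \<B>\<close> by (auto simp: \<B>_def)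
    have "openin (\<tau> i) (if i \<in> J then A i else topspace (\<tau> i))" if "i \<in> I" for i
      using JA B(2) that by (auto simp: PiE_iff)
    moreover have "finite {i \<in> I. (if i \<in> J then A i else topspace (\<tau> i)) \<noteq> topspace (\<tau> i)}"
      by (rule finite_subset[OF _ JA(1)]) auto
    ultimately show ?thesis unfolding JA(4) box_def by (simp add: openin_PiE_gen)
  qed
  have bB: "\<exists>V\<in>\<B>. x \<in> V \<and> V \<subseteq> U" if U: "openin ?P U" and x: "x \<in> U" for U x
  proof -
    obtain W where W: "finite {i \<in> I. W i \<noteq> topspace (\<tau> i)}" "\<And>i. i \<in> I \<Longrightarrow> openin (\<tau> i) (W i)"
      "x \<in> PiE I W" "PiE I W \<subseteq> U"
      using bspec[OF U[unfolded openin_product_topology_alt] x] by blast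
    define J where "J = {i \<in> I. W i \<noteq> topspace (\<tau> i)}"
    have "\<exists>V. V \<in> B i \<and> x i \<in> V \<and> V \<subseteq> W i" if "i \<in> J" for i
      using B(3)[of i "W i" "x i"] W(2,3) that by (auto simp: J_def)
    then obtain A where A: "\<And>i. i \<in> J \<Longrightarrow> A i \<in> B i \<and> x i \<in> A i \<and> A i \<subseteq> W i" by metis
    have "box J (restrict A J) \<in> \<B>"
      unfolding \<B>_def
    proof (rule image_eqI)
      show "(J, restrict A J) \<in> (SIGMA J : {J. finite J \<and> J \<subseteq> I}. PiE J B)"
        using A W(1) unfolding J_def[symmetric] by (auto simp: J_def)
    qed simp
    moreover have "x \<in> box J (restrict A J)"
      using A W(3) by (auto simp: box_def J_def PiE_iff)
    moreover have "box J (restrict A J) \<subseteq> PiE I W"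
      unfolding box_def using A by (intro PiE_mono) (auto simp: J_def)
    ultimately show ?thesis using W(4) by (meson subset_trans)
  qed
  have sB: "V \<in> sets (PiM I M)" if "V \<in> \<B>" for V
  proof -
    obtain J A where JA: "finite J" "J \<subseteq> I" "A \<in> PiE J B" "V = box J A"
      using \<open>V \<in> \<B>\<close> by (auto simp: \<B>_def)
    show ?thesis unfolding JA(4) box_def
    proof (rule sets_PiM_I_countable[OF I])
      fix i assume i: "i \<in> I"
      show "(if i \<in> J then A i else topspace (\<tau> i)) \<in> sets (M i)"
        using JA(3) B(2)[OF i] t(3,4)[OF i] by (auto simp: PiE_iff intro: sigma_sets.Basic)
    qed
  qed
  have "sets (PiM I M) = sigma_sets (space (PiM I M)) {U. openin ?P U}"
  proof
    let ?N = "sigma (space (PiM I M)) {U. openin ?P U}"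
    have sub: "{U. openin ?P U} \<subseteq> Pow (space (PiM I M))"
      using openin_subset[of ?P] top by auto
    then have spN: "space ?N = space (PiM I M)" and seN: "sets ?N = sigma_sets (space (PiM I M)) {U. openin ?P U}"
      by (auto simp: space_measure_of_conv sets_measure_of)
    have "sets (PiM I M) \<subseteq> sets ?N"
    proof (rule sets_PiM_in_sets)
      show "space ?N = (\<Pi>\<^sub>E i\<in>I. space (M i))" using spN by (simp add: space_PiM)
      fix i A assume i: "i \<in> I" and A: "A \<in> sets (M i)"
      have "(\<lambda>x. x i) \<in> measurable ?N (M i)"
      proof (rule measurable_sigma_sets[OF t(4)[OF i]])
        show "{U. openin (\<tau> i) U} \<subseteq> Pow (space (M i))" using t(3)[OF i] openin_subset by blast
        show "(\<lambda>x. x i) \<in> space ?N \<rightarrow> space (M i)" using i spN by (auto simp: space_PiM)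
        fix U assume "U \<in> {U. openin (\<tau> i) U}"
        then have "openin ?P {x \<in> topspace ?P. x i \<in> U}"
          using continuous_map_product_projection[OF i, of \<tau>] by (auto simp: continuous_map_def)
        moreover have "(\<lambda>x. x i) -` U \<inter> space ?N = {x \<in> topspace ?P. x i \<in> U}"
          using spN top by auto
        ultimately show "(\<lambda>x. x i) -` U \<inter> space ?N \<in> sets ?N" unfolding seN by (simp add: sigma_sets.Basic)
      qed
      from measurable_sets[OF this A] show "{x \<in> space ?N. x i \<in> A} \<in> sets ?N"
        by (simp add: vimage_def Int_def conj_commute)
    qed
    then show "sets (PiM I M) \<subseteq> sigma_sets (space (PiM I M)) {U. openin ?P U}" using seN by simp
    show "sigma_sets (space (PiM I M)) {U. openin ?P U} \<subseteq> sets (PiM I M)"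
    proof (rule sets.sigma_sets_subset, rule subsetI)
      fix U assume "U \<in> {U. openin ?P U}"
      then have "openin ?P U" by simp
      then have "U = \<Union>{V \<in> \<B>. V \<subseteq> U}" using bB[of U] by fast
      moreover have "\<Union>{V \<in> \<B>. V \<subseteq> U} \<in> sets (PiM I M)"
        using cB sB by (intro sets.countable_Union) (auto intro: countable_subset[of _ \<B>])
      ultimately show "U \<in> sets (PiM I M)" by simp
    qed
  qed
  moreover have "completely_metrizable_space ?P"
    using I t(1) by (auto simp: completely_metrizable_space_product_topology intro: countable_subset[of _ I])
  moreover have "second_countable ?P"
    unfolding second_countable_def using cB oB bB by (intro exI[of _ \<B>]) simp
  ultimately show ?thesis unfolding standard_borel_def using top by blast
qed

section \<open>Transfer functions\<close>

lemma measure_eqI_rectangles: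
  assumes P: "sets P = sets (M \<Otimes>\<^sub>M N)" and Q: "sets Q = sets (M \<Otimes>\<^sub>M N)" and "finite_measure P"
    and eq: "\<And>A B. A \<in> sets M \<Longrightarrow> B \<in> sets N \<Longrightarrow> emeasure P (A \<times> B) = emeasure Q (A \<times> B)"
  shows "P = Q"
proof (rule measure_eqI_generator_eq[OF Int_stable_pair_measure_generator pair_measure_closed])
  interpret finite_measure P by fact
  show "sets P = sigma_sets (space M \<times> space N) {a \<times> b |a b. a \<in> sets M \<and> b \<in> sets N}"
    "sets Q = sigma_sets (space M \<times> space N) {a \<times> b |a b. a \<in> sets M \<and> b \<in> sets N}"
    using P Q by (simp_all add: sets_pair_measure)
  show "range (\<lambda>_::nat. space M \<times> space N) \<subseteq> {a \<times> b |a b. a \<in> sets M \<and> b \<in> sets N}" by auto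
qed (auto intro: eq simp: finite_measure.emeasure_finite[OF assms(3), unfolded infinity_ennreal_def])

text \<open>Once the side \<open>A\<close> is fixed, \<open>C\<close> going to the measure of
  \<open>A \<times> C\<close> is a Borel measure on the line, and finiteness of \<open>P\<close>
  lets open half-lines determine it. This measure is \<open>R K\<close>, the image under
  \<open>snd\<close> of the restriction of \<open>K\<close> to
  \<open>A \<times> UNIV\<close>.\<close>

lemma measure_eqI_rectangles_lessThan:
  fixes P Q :: "('a \<times> real) measure"
  assumes P: "sets P = sets (M \<Otimes>\<^sub>M borel)" and Q: "sets Q = sets (M \<Otimes>\<^sub>M borel)" and fin: "finite_measure P"
    and eq: "\<And>A t. A \<in> sets M \<Longrightarrow> emeasure P (A \<times> {..<t}) = emeasure Q (A \<times> {..<t})"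
  shows "P = Q"
proof (rule measure_eqI_rectangles[OF P Q fin])
  fix A B assume A: "A \<in> sets M" and B: "B \<in> sets (borel :: real measure)"
  define R where "R K = distr (density K (indicator (A \<times> UNIV))) borel snd" for K :: "('a \<times> real) measure"
  have R: "emeasure (R K) C = emeasure K (A \<times> C)"
    if K: "sets K = sets (M \<Otimes>\<^sub>M borel)" and C: "C \<in> sets borel" for K C
  proof -
    have spK: "space K = space M \<times> UNIV" using sets_eq_imp_space_eq[OF K] by (simp add: space_pair_measure)
    have [measurable]: "snd \<in> borel_measurable K" using K by (simp cong: measurable_cong_sets)
    have "emeasure (R K) C = emeasure (density K (indicator (A \<times> UNIV))) (snd -` C \<inter> space K)"
      unfolding R_def using C by (subst emeasure_distr) simp_all
    also have "\<dots> = emeasure K ((A \<times> UNIV) \<inter> (snd -` C \<inter> space K))"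
      using A C K measurable_sets[of snd K borel C] by (intro emeasure_restricted) auto
    also have "(A \<times> UNIV) \<inter> (snd -` C \<inter> space K) = A \<times> C"
      using sets.sets_into_space[OF A] spK by auto
    finally show ?thesis .
  qed
  have "R P = R Q"
  proof (rule measure_eqI_generator_eq[of "range lessThan" UNIV "R P" "R Q" "\<lambda>n. {..<real n}"])
    show "Int_stable (range (lessThan :: real \<Rightarrow> _))"
    proof (rule Int_stableI_image)
      fix a b :: real
      have "{..<a} \<inter> {..<b} = {..<min a b}" by auto
      then show "\<exists>c\<in>UNIV. {..<a} \<inter> {..<b} = {..<c}" by blast
    qed
    show "emeasure (R P) X = emeasure (R Q) X" if "X \<in> range lessThan" for X
      using that A by (auto simp: R P Q eq)
    show "sets (R P) = sigma_sets UNIV (range lessThan)" "sets (R Q) = sigma_sets UNIV (range lessThan)"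
      unfolding R_def sets_distr by (subst borel_Iio, simp)+
    show "(\<Union>i. {..<real i}) = UNIV" using reals_Archimedean2 by auto
    show "emeasure (R P) {..<real i} \<noteq> \<infinity>" for i
      using finite_measure.emeasure_finite[OF fin] by (simp add: R P)
    show "range (lessThan :: real \<Rightarrow> _) \<subseteq> Pow UNIV" by simp
    show "range (\<lambda>i. {..<real i}) \<subseteq> range lessThan" by blast
  qed
  then show "emeasure P (A \<times> B) = emeasure Q (A \<times> B)"
    unfolding R[OF P B, symmetric] R[OF Q B, symmetric] by (rule arg_cong)
qed

text \<open>The test set is the one where \<open>g < f\<close>: were it not null, the finite
  integral of \<open>g\<close> over it would be strictly below that of \<open>f\<close>.\<close>

lemma AE_le_of_set_nn_integral_le:
  assumes [measurable]: "f \<in> borel_measurable M" "g \<in> borel_measurable M"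
    and fin: "(\<integral>\<^sup>+x. g x \<partial>M) \<noteq> \<infinity>"
    and le: "\<And>A. A \<in> sets M \<Longrightarrow> (\<integral>\<^sup>+x. f x * indicator A x \<partial>M) \<le> (\<integral>\<^sup>+x. g x * indicator A x \<partial>M)"
  shows "AE x in M. f x \<le> g x"
proof (rule ccontr)
  assume not: "\<not> (AE x in M. f x \<le> g x)"
  let ?D = "{x \<in> space M. g x < f x}"
  have "(\<integral>\<^sup>+x. g x * indicator ?D x \<partial>M) < (\<integral>\<^sup>+x. f x * indicator ?D x \<partial>M)"
  proof (rule nn_integral_less)
    have "(\<integral>\<^sup>+x. g x * indicator ?D x \<partial>M) \<le> (\<integral>\<^sup>+x. g x \<partial>M)"
      by (intro nn_integral_mono) (auto split: split_indicator)
    then show "(\<integral>\<^sup>+x. g x * indicator ?D x \<partial>M) \<noteq> \<infinity>" using fin by (auto simp: top_unique)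
    show "AE x in M. g x * indicator ?D x \<le> f x * indicator ?D x"
      by (intro AE_I2) (auto split: split_indicator)
    show "\<not> (AE x in M. f x * indicator ?D x \<le> g x * indicator ?D x)"
    proof
      assume "AE x in M. f x * indicator ?D x \<le> g x * indicator ?D x"
      then have "AE x in M. f x \<le> g x"
        using AE_space by eventually_elim (auto split: split_indicator_asm simp: not_less)
      with not show False ..
    qed
  qed measurable
  moreover have "(\<integral>\<^sup>+x. f x * indicator ?D x \<partial>M) \<le> (\<integral>\<^sup>+x. g x * indicator ?D x \<partial>M)"
    by (rule le) measurable
  ultimately show False by simp
qed

section \<open>Conditional distribution functions\<close>

text \<open>The function \<open>h\<close> is the conditional probability of \<open>B\<close> given
  the value of \<open>b\<close>. It is a Radon-Nikodym derivative: the image under \<open>b\<close>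
  of \<open>M\<close> restricted to \<open>B\<close> is absolutely continuous with respect to
  \<open>N\<close>, the image of all of \<open>M\<close>.\<close>

lemma conditional_probability_given_map:
  assumes "prob_space M" and b [measurable]: "b \<in> measurable M N" and N: "distr M N b = N"
    and B [measurable]: "B \<in> sets M"
  obtains h :: "'b \<Rightarrow> ennreal" where "h \<in> borel_measurable N"
    "\<And>A. A \<in> sets N \<Longrightarrow> (\<integral>\<^sup>+x. h x * indicator A x \<partial>N) = emeasure M {y \<in> B. b y \<in> A}"
proof -
  interpret M: prob_space M by fact
  interpret N: prob_space N using M.prob_space_distr[OF b] N by simp
  let ?K = "distr (density M (indicator B)) N b"
  have K: "emeasure ?K A = emeasure M {y \<in> B. b y \<in> A}" if A [measurable]: "A \<in> sets N" for A
  proof -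
    have "emeasure ?K A = emeasure (density M (indicator B)) (b -` A \<inter> space M)"
      by (subst emeasure_distr) auto
    also have "\<dots> = emeasure M (B \<inter> (b -` A \<inter> space M))"
      by (intro emeasure_restricted) auto
    also have "B \<inter> (b -` A \<inter> space M) = {y \<in> B. b y \<in> A}" using sets.sets_into_space[OF B] by auto
    finally show ?thesis .
  qed
  have "absolutely_continuous N ?K"
    unfolding absolutely_continuous_def
  proof
    fix A assume "A \<in> null_sets N"
    then have A [measurable]: "A \<in> sets N" and "emeasure (distr M N b) A = 0" using N by auto
    then have "emeasure M (b -` A \<inter> space M) = 0" by (subst (asm) emeasure_distr) auto
    then have "emeasure M {y \<in> B. b y \<in> A} = 0"
      using sets.sets_into_space[OF B]
      by (elim emeasure_eq_0[OF measurable_sets[OF b A]]) auto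
    then show "A \<in> null_sets ?K" using A K[OF A] by auto
  qed
  from N.Radon_Nikodym[OF this] obtain h where h: "h \<in> borel_measurable N" "density N h = ?K" by auto
  show ?thesis
  proof (rule that[OF h(1)])
    fix A assume A: "A \<in> sets N"
    have "(\<integral>\<^sup>+x. h x * indicator A x \<partial>N) = emeasure (density N h) A"
      by (rule emeasure_density[OF h(1) A, symmetric])
    then show "(\<integral>\<^sup>+x. h x * indicator A x \<partial>N) = emeasure M {y \<in> B. b y \<in> A}"
      unfolding h(2) K[OF A] .
  qed
qed

text \<open>Conditional probabilities of \<open>\<phi> y \<le> of_rat q\<close> are monotone in
  \<open>q\<close> and bounded by 1 almost everywhere; since the levels are rational, countably many
  null sets cover all exceptions. A modification on a null set gives both properties
  everywhere.\<close>

lemma conditional_distribution_function: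
  fixes \<phi> :: "'a \<Rightarrow> real"
  assumes "prob_space M" and b [measurable]: "b \<in> measurable M N" and N: "distr M N b = N"
    and phi [measurable]: "\<phi> \<in> borel_measurable M"
  obtains F :: "rat \<Rightarrow> 'b \<Rightarrow> ennreal" where "\<And>q. F q \<in> borel_measurable N" "\<And>q x. F q x \<le> 1"
    "\<And>p q x. p \<le> q \<Longrightarrow> F p x \<le> F q x"
    "\<And>q A. A \<in> sets N \<Longrightarrow> (\<integral>\<^sup>+x. F q x * indicator A x \<partial>N) = emeasure M {y \<in> space M. b y \<in> A \<and> \<phi> y \<le> of_rat q}"
proof -
  interpret M: prob_space M by fact
  interpret N: prob_space N using M.prob_space_distr[OF b] N by simp
  define B where "B q = {y \<in> space M. \<phi> y \<le> of_rat q}" for q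
  have B [measurable]: "B q \<in> sets M" for q unfolding B_def by measurable
  have "\<exists>h::'b \<Rightarrow> ennreal. h \<in> borel_measurable N \<and>
      (\<forall>A. A \<in> sets N \<longrightarrow> (\<integral>\<^sup>+x. h x * indicator A x \<partial>N) = emeasure M {y \<in> B q. b y \<in> A})" for q
    by (rule conditional_probability_given_map[OF assms(1) b N B[of q]]) blast
  then have "\<exists>h::rat \<Rightarrow> 'b \<Rightarrow> ennreal. \<forall>q. h q \<in> borel_measurable N \<and>
      (\<forall>A. A \<in> sets N \<longrightarrow> (\<integral>\<^sup>+x. h q x * indicator A x \<partial>N) = emeasure M {y \<in> B q. b y \<in> A})"
    by (intro choice allI)
  then obtain h :: "rat \<Rightarrow> 'b \<Rightarrow> ennreal" where hm [measurable]: "\<And>q. h q \<in> borel_measurable N" and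
    h: "\<And>q A. A \<in> sets N \<Longrightarrow> (\<integral>\<^sup>+x. h q x * indicator A x \<partial>N) = emeasure M {y \<in> B q. b y \<in> A}"
    by blast
  have fin: "(\<integral>\<^sup>+x. h q x \<partial>N) \<noteq> \<infinity>" for q
  proof -
    have "(\<integral>\<^sup>+x. h q x \<partial>N) = (\<integral>\<^sup>+x. h q x * indicator (space N) x \<partial>N)"
      by (intro nn_integral_cong) auto
    also have "\<dots> \<noteq> \<infinity>" using h[of "space N" q] by simp
    finally show ?thesis .
  qed
  have "AE x in N. h p x \<le> h q x" if "p \<le> q" for p q
  proof (rule AE_le_of_set_nn_integral_le[OF hm hm fin])
    fix A assume A [measurable]: "A \<in> sets N"
    show "(\<integral>\<^sup>+x. h p x * indicator A x \<partial>N) \<le> (\<integral>\<^sup>+x. h q x * indicator A x \<partial>N)"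
      unfolding h[OF A]
    proof (rule emeasure_mono)
      show "{y \<in> B p. b y \<in> A} \<subseteq> {y \<in> B q. b y \<in> A}"
        using that by (auto simp: B_def intro: order_trans of_rat_less_eq[THEN iffD2])
      have "{y \<in> B q. b y \<in> A} = {y \<in> space M. \<phi> y \<le> of_rat q \<and> b y \<in> A}" by (auto simp: B_def)
      then show "{y \<in> B q. b y \<in> A} \<in> sets M" by simp
    qed
  qed
  then have mono: "AE x in N. \<forall>p q. p \<le> q \<longrightarrow> h p x \<le> h q x"
    by (simp add: AE_all_countable)
  have le1: "AE x in N. h q x \<le> 1" for q
  proof (rule AE_le_of_set_nn_integral_le)
    fix A assume A [measurable]: "A \<in> sets N"
    have "emeasure M {y \<in> B q. b y \<in> A} \<le> emeasure M (b -` A \<inter> space M)"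
      by (intro emeasure_mono) (auto simp: B_def)
    also have "\<dots> = emeasure (distr M N b) A" by (rule emeasure_distr[symmetric]) auto
    finally show "(\<integral>\<^sup>+x. h q x * indicator A x \<partial>N) \<le> (\<integral>\<^sup>+x. 1 * indicator A x \<partial>N)"
      using N by (simp add: h)
  qed (auto simp: N.emeasure_space_1)
  \<comment> \<open>The supremum over lower levels forces monotonicity and the minimum forces the
    bound. Where \<open>h\<close> already has both properties nothing changes, so the integrals are
    kept.\<close>
  define F where "F q x = min 1 (SUP p\<in>{..q}. h p x)" for q x
  have "AE x in N. F q x = h q x" for q
    using mono le1[of q]
  proof eventually_elim
    case (elim x)
    then have "(SUP p\<in>{..q}. h p x) = h q x" by (intro antisym SUP_least SUP_upper) auto
    then show ?case using elim by (simp add: F_def min_def)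
  qed
  then have F_int: "(\<integral>\<^sup>+x. F q x * indicator A x \<partial>N) = emeasure M {y \<in> space M. b y \<in> A \<and> \<phi> y \<le> of_rat q}"
    if "A \<in> sets N" for q A
  proof -
    have "(\<integral>\<^sup>+x. F q x * indicator A x \<partial>N) = (\<integral>\<^sup>+x. h q x * indicator A x \<partial>N)"
      using \<open>AE x in N. F q x = h q x\<close> by (intro nn_integral_cong_AE) (auto elim!: eventually_mono)
    also have "\<dots> = emeasure M {y \<in> space M. b y \<in> A \<and> \<phi> y \<le> of_rat q}"
      unfolding h[OF that] B_def by (intro arg_cong[of _ _ "emeasure M"]) auto
    finally show ?thesis .
  qed
  show ?thesis
  proof (rule that[of F])
    show "F q \<in> borel_measurable N" for q unfolding F_def by measurable
    show "F q x \<le> 1" for q x by (simp add: F_def)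
    show "F p x \<le> F q x" if "p \<le> q" for p q x
    proof -
      have "(SUP r\<in>{..p}. h r x) \<le> (SUP r\<in>{..q}. h r x)"
        using that by (intro SUP_subset_mono) auto
      then show ?thesis unfolding F_def by (rule min.mono[OF order_refl])
    qed
  qed (fact F_int)
qed

section \<open>Conditional quantiles with a uniform seed\<close>

abbreviation unif :: "real measure" where "unif \<equiv> uniform_measure lborel {0..1}"

lemma prob_space_unif: "prob_space unif"
  by (rule prob_space_uniform_measure) auto

lemma emeasure_unif_le: "g \<le> 1 \<Longrightarrow> emeasure unif {u. ennreal u \<le> g} = g"
proof -
  assume g: "g \<le> 1"
  then obtain r where r: "g = ennreal r" "0 \<le> r" "r \<le> 1"
    by (cases g) (auto simp: top_unique)
  \<comment> \<open>As \<open>ennreal\<close> sends negative reals to 0, the set also contains the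
    negative half-line; the intersection with the support of \<open>unif\<close> removes it.\<close>
  have "{0..1} \<inter> {u. ennreal u \<le> g} = {0..r}"
    using r by (auto simp: ennreal_le_iff)
  then show ?thesis
    using r by (subst emeasure_uniform_measure) (auto simp: divide_ennreal_def)
qed


text \<open>Running maxima of an enumeration. They turn a union over the rationals below a bound
  into an increasing union, to which continuity of measures applies.\<close>

lemma countable_cofinal_incseq:
  fixes R :: "'a :: linorder set"
  assumes "countable R" "R \<noteq> {}"
  obtains p :: "nat \<Rightarrow> 'a" where "incseq p" "\<And>n. p n \<in> R" "\<And>r. r \<in> R \<Longrightarrow> \<exists>n. r \<le> p n"
proof -
  let ?p = "\<lambda>n. Max (from_nat_into R ` {..n})"
  have "incseq ?p" by (rule monoI) (intro Max_mono, auto)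
  moreover have "?p n \<in> R" for n
  proof -
    have "from_nat_into R ` {..n} \<subseteq> R" using from_nat_into[OF assms(2)] by auto
    moreover have "?p n \<in> from_nat_into R ` {..n}" by (rule Max_in) auto
    ultimately show ?thesis by (rule subsetD)
  qed
  moreover have "\<exists>n. r \<le> ?p n" if "r \<in> R" for r
    using that assms(1) by (intro exI[of _ "to_nat_on R r"] Max_ge) (auto simp: image_iff intro!: bexI[of _ "to_nat_on R r"])
  ultimately show ?thesis by (rule that)
qed

text \<open>For \<open>0 < t \<le> 1\<close>, \<open>f (x, u) < t\<close> means
  \<open>ennreal u \<le> F p x\<close> for some nonnegative rational \<open>p\<close> with
  \<open>of_rat p < t\<close>. A uniform seed satisfies the condition at \<open>p\<close> with
  probability \<open>F p x\<close>, the conditional probability of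
  \<open>\<phi> y \<le> of_rat p\<close>. Letting \<open>p\<close> increase to \<open>t\<close>
  matches the events \<open>f z < t\<close> and \<open>\<phi> y < t\<close> jointly with the base
  point. Strict sublevel sets are the ones that are such countable unions.\<close>

lemma transfer_function_real:
  fixes \<phi> :: "'a \<Rightarrow> real"
  assumes "prob_space M" and b [measurable]: "b \<in> measurable M N" and N: "distr M N b = N"
    and phi [measurable]: "\<phi> \<in> borel_measurable M"
    and bounds: "\<And>y. y \<in> space M \<Longrightarrow> 0 \<le> \<phi> y \<and> \<phi> y < 1"
  obtains f where "f \<in> borel_measurable (N \<Otimes>\<^sub>M unif)"
    "distr (N \<Otimes>\<^sub>M unif) (N \<Otimes>\<^sub>M borel) (\<lambda>(x, u). (x, f (x, u))) = distr M (N \<Otimes>\<^sub>M borel) (\<lambda>y. (b y, \<phi> y))"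
proof -
  interpret M: prob_space M by fact
  interpret N: prob_space N using M.prob_space_distr[OF b] N by simp
  interpret U: prob_space unif by (rule prob_space_unif)
  interpret NU: pair_prob_space N unif ..
  obtain F :: "rat \<Rightarrow> 'b \<Rightarrow> ennreal" where F [measurable]: "\<And>q. F q \<in> borel_measurable N" and F1: "\<And>q x. F q x \<le> 1"
    and mono: "\<And>p q x. p \<le> q \<Longrightarrow> F p x \<le> F q x"
    and F_int: "\<And>q A. A \<in> sets N \<Longrightarrow> (\<integral>\<^sup>+x. F q x * indicator A x \<partial>N) = emeasure M {y \<in> space M. b y \<in> A \<and> \<phi> y \<le> of_rat q}"
    by (rule conditional_distribution_function[OF assms(1) b N phi]) (rule that)
  \<comment> \<open>The conditional quantile function; the element \<open>1\<close> keeps the set nonempty.\<close>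
  define f :: "'b \<times> real \<Rightarrow> real" where "f = (\<lambda>(x, u). Inf (insert 1 {of_rat p | p. 0 \<le> p \<and> ennreal u \<le> F p x}))"
  have f_less: "f (x, u) < t \<longleftrightarrow> 1 < t \<or> (\<exists>p. 0 \<le> p \<and> of_rat p < t \<and> ennreal u \<le> F p x)" for x u t
  proof -
    let ?S = "insert 1 {of_rat p | p. 0 \<le> p \<and> ennreal u \<le> F p x} :: real set"
    have "bdd_below ?S" by (rule bdd_belowI[of _ 0]) auto
    then have "Inf ?S < t \<longleftrightarrow> (\<exists>s\<in>?S. s < t)" by (intro cInf_less_iff) auto
    then show ?thesis unfolding f_def by auto
  qed
  have f [measurable]: "f \<in> borel_measurable (N \<Otimes>\<^sub>M unif)"
  proof (rule borel_measurableI_less)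
    fix t
    have "{z \<in> space (N \<Otimes>\<^sub>M unif). f z < t} =
        {z \<in> space (N \<Otimes>\<^sub>M unif). 1 < t \<or> (\<exists>p. 0 \<le> p \<and> of_rat p < t \<and> ennreal (snd z) \<le> F p (fst z))}"
      using f_less by auto
    also have "\<dots> \<in> sets (N \<Otimes>\<^sub>M unif)" by measurable
    finally show "{z \<in> space (N \<Otimes>\<^sub>M unif). f z < t} \<in> sets (N \<Otimes>\<^sub>M unif)" .
  qed
  have rect: "emeasure (N \<Otimes>\<^sub>M unif) {z \<in> space (N \<Otimes>\<^sub>M unif). fst z \<in> A \<and> ennreal (snd z) \<le> F p (fst z)} =
      emeasure M {y \<in> space M. b y \<in> A \<and> \<phi> y \<le> of_rat p}" if A [measurable]: "A \<in> sets N" for A p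
  proof -
    let ?E = "{z \<in> space (N \<Otimes>\<^sub>M unif). fst z \<in> A \<and> ennreal (snd z) \<le> F p (fst z)}"
    have "emeasure (N \<Otimes>\<^sub>M unif) ?E = (\<integral>\<^sup>+x. emeasure unif (Pair x -` ?E) \<partial>N)"
      by (rule U.emeasure_pair_measure_alt) measurable
    also have "\<dots> = (\<integral>\<^sup>+x. F p x * indicator A x \<partial>N)"
    proof (rule nn_integral_cong)
      fix x assume x: "x \<in> space N"
      then have "Pair x -` ?E = (if x \<in> A then {u. ennreal u \<le> F p x} else {})"
        by (auto simp: space_pair_measure)
      then show "emeasure unif (Pair x -` ?E) = F p x * indicator A x"
        by (simp only: emeasure_unif_le[OF F1] split: if_split) auto
    qed
    finally show ?thesis using F_int[OF A] by simp
  qed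
  have less: "emeasure (N \<Otimes>\<^sub>M unif) {z \<in> space (N \<Otimes>\<^sub>M unif). fst z \<in> A \<and> f z < t} =
      emeasure M {y \<in> space M. b y \<in> A \<and> \<phi> y < t}" if A [measurable]: "A \<in> sets N" for A t
  proof -
    \<comment> \<open>Both variables are nonnegative, so the first case compares empty sets. Above 1
      both conditions on the value are vacuous, because \<open>f\<close> is at most 1 and
      \<open>\<phi>\<close> is below 1. In between, the inserted element 1 has no influence.\<close>
    consider "t \<le> 0" | "0 < t" "t \<le> 1" | "1 < t" by linarith
    then show ?thesis
    proof cases
      case 1
      have "{z \<in> space (N \<Otimes>\<^sub>M unif). fst z \<in> A \<and> f z < t} = {}"
      proof -
        have "\<not> f z < t" for z
        proof (cases z)
          case (Pair x u)
          have "\<not> of_rat p < t" if "0 \<le> p" for p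
            using 1 that by (meson less_le_trans not_less zero_le_of_rat_iff)
          then show ?thesis using 1 Pair f_less by auto
        qed
        then show ?thesis by auto
      qed
      moreover have "{y \<in> space M. b y \<in> A \<and> \<phi> y < t} = {}" using 1 bounds by force
      ultimately show ?thesis by (simp only: emeasure_empty)
    next
      case 2
      let ?R = "{p. 0 \<le> p \<and> of_rat p < t}"
      have R: "countable ?R" "?R \<noteq> {}" using 2 by (auto intro: exI[of _ 0])
      obtain p where p: "incseq p" "\<And>n. p n \<in> ?R" "\<And>r. r \<in> ?R \<Longrightarrow> \<exists>n. r \<le> p n"
        by (rule countable_cofinal_incseq[OF R]) (rule that)
      let ?E = "\<lambda>n. {z \<in> space (N \<Otimes>\<^sub>M unif). fst z \<in> A \<and> ennreal (snd z) \<le> F (p n) (fst z)}"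
      let ?D = "\<lambda>n. {y \<in> space M. b y \<in> A \<and> \<phi> y \<le> of_rat (p n)}"
      have "{z \<in> space (N \<Otimes>\<^sub>M unif). fst z \<in> A \<and> f z < t} = (\<Union>n. ?E n)"
      proof -
        have "f (x, u) < t \<longleftrightarrow> (\<exists>n. ennreal u \<le> F (p n) x)" for x u
        proof
          assume "f (x, u) < t"
          then obtain r where r: "r \<in> ?R" "ennreal u \<le> F r x" unfolding f_less using 2 by auto
          then obtain n where "r \<le> p n" using p(3) by blast
          from order_trans[OF r(2) mono[OF this]] show "\<exists>n. ennreal u \<le> F (p n) x" ..
        next
          assume "\<exists>n. ennreal u \<le> F (p n) x"
          then show "f (x, u) < t" unfolding f_less using p(2) by auto
        qed
        then show ?thesis by auto
      qed
      moreover have "{y \<in> space M. b y \<in> A \<and> \<phi> y < t} = (\<Union>n. ?D n)"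
      proof -
        have "\<phi> y < t \<longleftrightarrow> (\<exists>n. \<phi> y \<le> of_rat (p n))" if y: "y \<in> space M" for y
        proof
          assume "\<phi> y < t"
          then obtain r where r: "\<phi> y < of_rat r" "of_rat r < t" using of_rat_dense by blast
          then have "(0::real) \<le> of_rat r" using bounds[OF y] by linarith
          then have "r \<in> ?R" using r by simp
          then obtain n where "r \<le> p n" using p(3) by blast
          then have "(of_rat r :: real) \<le> of_rat (p n)" by (simp add: of_rat_less_eq)
          then show "\<exists>n. \<phi> y \<le> of_rat (p n)" using r by (intro exI[of _ n]) linarith
        next
          assume "\<exists>n. \<phi> y \<le> of_rat (p n)"
          then show "\<phi> y < t" using p(2) by (auto intro: le_less_trans)
        qed
        then show ?thesis by auto
      qed
      moreover have "(SUP n. emeasure (N \<Otimes>\<^sub>M unif) (?E n)) = emeasure (N \<Otimes>\<^sub>M unif) (\<Union>n. ?E n)"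
      proof (rule SUP_emeasure_incseq)
        have "?E n \<in> sets (N \<Otimes>\<^sub>M unif)" for n by measurable
        then show "range ?E \<subseteq> sets (N \<Otimes>\<^sub>M unif)" by blast
        show "incseq ?E"
        proof (rule monoI)
          fix m n :: nat assume "m \<le> n"
          from mono[OF monoD[OF p(1) this]] show "?E m \<subseteq> ?E n" by (auto intro: order_trans)
        qed
      qed
      moreover have "(SUP n. emeasure M (?D n)) = emeasure M (\<Union>n. ?D n)"
      proof (rule SUP_emeasure_incseq)
        have "(of_rat (p m) :: real) \<le> of_rat (p n)" if "m \<le> n" for m n
          using monoD[OF p(1) that] by (simp add: of_rat_less_eq)
        then show "incseq ?D" by (intro monoI) (auto intro: order_trans)
        have "?D n \<in> sets M" for n by measurable
        then show "range ?D \<subseteq> sets M" by blast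
      qed
      ultimately show ?thesis by (simp add: rect)
    next
      case 3
      have "{z \<in> space (N \<Otimes>\<^sub>M unif). fst z \<in> A \<and> f z < t} = A \<times> space unif"
        using 3 f_less sets.sets_into_space[OF A] by (auto simp: space_pair_measure)
      then have "emeasure (N \<Otimes>\<^sub>M unif) {z \<in> space (N \<Otimes>\<^sub>M unif). fst z \<in> A \<and> f z < t} = emeasure N A"
        using U.emeasure_pair_measure_Times[OF A sets.top[of unif]] U.emeasure_space_1 by simp
      also have "\<dots> = emeasure (distr M N b) A" using N by simp
      also have "\<dots> = emeasure M (b -` A \<inter> space M)" by (rule emeasure_distr) auto
      also have "b -` A \<inter> space M = {y \<in> space M. b y \<in> A \<and> \<phi> y < t}" using 3 bounds by force
      finally show ?thesis .
    qed
  qed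
  have "distr (N \<Otimes>\<^sub>M unif) (N \<Otimes>\<^sub>M borel) (\<lambda>(x, u). (x, f (x, u))) = distr M (N \<Otimes>\<^sub>M borel) (\<lambda>y. (b y, \<phi> y))"
    (is "?P = ?Q")
  proof (rule measure_eqI_rectangles_lessThan)
    show "finite_measure ?P"
      by (intro prob_space.finite_measure NU.prob_space_distr) measurable
    fix A t assume A [measurable]: "A \<in> sets N"
    have "emeasure ?P (A \<times> {..<t}) = emeasure (N \<Otimes>\<^sub>M unif) ((\<lambda>(x, u). (x, f (x, u))) -` (A \<times> {..<t}) \<inter> space (N \<Otimes>\<^sub>M unif))"
      by (rule emeasure_distr) measurable
    also have "(\<lambda>(x, u). (x, f (x, u))) -` (A \<times> {..<t}) \<inter> space (N \<Otimes>\<^sub>M unif) =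
        {z \<in> space (N \<Otimes>\<^sub>M unif). fst z \<in> A \<and> f z < t}" by auto
    also note less[OF A]
    also have "{y \<in> space M. b y \<in> A \<and> \<phi> y < t} = (\<lambda>y. (b y, \<phi> y)) -` (A \<times> {..<t}) \<inter> space M" by auto
    also have "emeasure M \<dots> = emeasure ?Q (A \<times> {..<t})"
      by (rule emeasure_distr[symmetric]) measurable
    finally show "emeasure ?P (A \<times> {..<t}) = emeasure ?Q (A \<times> {..<t})" .
  qed auto
  with f show ?thesis by (rule that)
qed

text \<open>The real case is applied to the code \<open>\<phi>\<close>, and its output is decoded by
  \<open>\<psi>\<close>. The joint law is the right one because \<open>\<psi>\<close> inverts
  \<open>\<phi>\<close> on \<open>space M\<close>.\<close>

lemma transfer_function_standard_borel:
  assumes "prob_space M" and b [measurable]: "b \<in> measurable M N" and N: "distr M N b = N"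
    and sb: "standard_borel M"
  obtains f where "f \<in> measurable (N \<Otimes>\<^sub>M unif) M"
    "distr (N \<Otimes>\<^sub>M unif) (N \<Otimes>\<^sub>M M) (\<lambda>(x, u). (x, f (x, u))) = distr M (N \<Otimes>\<^sub>M M) (\<lambda>y. (b y, y))"
proof -
  interpret M: prob_space M by fact
  obtain \<phi> :: "'a \<Rightarrow> real" and \<psi> where phi [measurable]: "\<phi> \<in> borel_measurable M"
    and psi [measurable]: "\<psi> \<in> measurable borel M"
    and inv: "\<And>y. y \<in> space M \<Longrightarrow> 0 \<le> \<phi> y \<and> \<phi> y < 1 \<and> \<psi> (\<phi> y) = y"
    by (rule standard_borel_embed_real[OF sb M.not_empty]) (rule that)
  have bounds: "0 \<le> \<phi> y \<and> \<phi> y < 1" if "y \<in> space M" for y using inv[OF that] by simp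
  obtain f where f [measurable]: "f \<in> borel_measurable (N \<Otimes>\<^sub>M unif)" and
    eq: "distr (N \<Otimes>\<^sub>M unif) (N \<Otimes>\<^sub>M borel) (\<lambda>(x, u). (x, f (x, u))) = distr M (N \<Otimes>\<^sub>M borel) (\<lambda>y. (b y, \<phi> y))"
    by (rule transfer_function_real[OF assms(1) b N phi bounds]) (assumption, rule that)
  let ?p = "\<lambda>(x, r). (x, \<psi> r)"
  have "distr (N \<Otimes>\<^sub>M unif) (N \<Otimes>\<^sub>M M) (\<lambda>(x, u). (x, \<psi> (f (x, u)))) =
      distr (distr (N \<Otimes>\<^sub>M unif) (N \<Otimes>\<^sub>M borel) (\<lambda>(x, u). (x, f (x, u)))) (N \<Otimes>\<^sub>M M) ?p"
    by (subst distr_distr) (auto intro!: distr_cong simp: comp_def)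
  also have "\<dots> = distr M (N \<Otimes>\<^sub>M M) (\<lambda>y. (b y, y))"
    unfolding eq by (subst distr_distr) (auto intro!: distr_cong simp: comp_def inv)
  finally show ?thesis by (intro that[of "\<lambda>p. \<psi> (f p)"]) auto
qed

section \<open>Fibre laws and conditionally independent families\<close>

text \<open>The integral over \<open>B\<close> of the fibre probabilities of \<open>A\<close> is the
  joint law of \<open>B \<times> A\<close>, so both sides are densities of the same measure. The
  null set may depend on \<open>A\<close>.\<close>

lemma fibre_laws_eq:
  assumes "prob_space N" "prob_space U"
    and f [measurable]: "f \<in> measurable (N \<Otimes>\<^sub>M U) M" and g [measurable]: "g \<in> measurable (N \<Otimes>\<^sub>M U) M"
    and eq: "distr (N \<Otimes>\<^sub>M U) (N \<Otimes>\<^sub>M M) (\<lambda>(x, u). (x, f (x, u))) = distr (N \<Otimes>\<^sub>M U) (N \<Otimes>\<^sub>M M) (\<lambda>(x, u). (x, g (x, u)))"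
    and A [measurable]: "A \<in> sets M"
  shows "AE x in N. emeasure U {u \<in> space U. f (x, u) \<in> A} = emeasure U {u \<in> space U. g (x, u) \<in> A}"
proof -
  interpret N: prob_space N by fact
  interpret U: prob_space U by fact
  have meas: "(\<lambda>x. emeasure U {u \<in> space U. k (x, u) \<in> A}) \<in> borel_measurable N"
    if [measurable]: "k \<in> measurable (N \<Otimes>\<^sub>M U) M" for k
    by measurable
  have int: "(\<integral>\<^sup>+x\<in>B. emeasure U {u \<in> space U. k (x, u) \<in> A} \<partial>N) =
      emeasure (distr (N \<Otimes>\<^sub>M U) (N \<Otimes>\<^sub>M M) (\<lambda>(x, u). (x, k (x, u)))) (B \<times> A)"
    if k [measurable]: "k \<in> measurable (N \<Otimes>\<^sub>M U) M" and B [measurable]: "B \<in> sets N" for k B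
  proof -
    let ?E = "(\<lambda>(x, u). (x, k (x, u))) -` (B \<times> A) \<inter> space (N \<Otimes>\<^sub>M U)"
    have E: "?E \<in> sets (N \<Otimes>\<^sub>M U)" by measurable
    have "emeasure (distr (N \<Otimes>\<^sub>M U) (N \<Otimes>\<^sub>M M) (\<lambda>(x, u). (x, k (x, u)))) (B \<times> A) = emeasure (N \<Otimes>\<^sub>M U) ?E"
      by (rule emeasure_distr) measurable
    also have "\<dots> = (\<integral>\<^sup>+x. emeasure U (Pair x -` ?E) \<partial>N)"
      by (rule U.emeasure_pair_measure_alt[OF E])
    also have "\<dots> = (\<integral>\<^sup>+x\<in>B. emeasure U {u \<in> space U. k (x, u) \<in> A} \<partial>N)"
    proof (rule nn_integral_cong)
      fix x assume "x \<in> space N"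
      then have "Pair x -` ?E = (if x \<in> B then {u \<in> space U. k (x, u) \<in> A} else {})"
        by (auto simp: space_pair_measure)
      then show "emeasure U (Pair x -` ?E) = emeasure U {u \<in> space U. k (x, u) \<in> A} * indicator B x"
        by (simp only: split: if_split) auto
    qed
    finally show ?thesis by simp
  qed
  show ?thesis
    by (rule N.density_unique2) (simp_all add: meas[OF f] meas[OF g] int[OF f] int[OF g] eq)
qed

text \<open>Given \<open>x\<close>, the coordinates depend on independent seeds, so a cylinder has
  as probability the integral over \<open>x\<close> of a finite product of fibre probabilities. Each
  cylinder involves finitely many null sets, hence the index set is arbitrary.\<close>

lemma distr_conditional_product_eqI:
  fixes F F' :: "'i \<Rightarrow> 'a \<times> 'u \<Rightarrow> 'b"
  assumes "prob_space N" "prob_space U"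
    and F [measurable]: "\<And>i. i \<in> I \<Longrightarrow> F i \<in> measurable (N \<Otimes>\<^sub>M U) M"
    and F' [measurable]: "\<And>i. i \<in> I \<Longrightarrow> F' i \<in> measurable (N \<Otimes>\<^sub>M U) M"
    and eq: "\<And>i A. i \<in> I \<Longrightarrow> A \<in> sets M \<Longrightarrow>
      AE x in N. emeasure U {u \<in> space U. F i (x, u) \<in> A} = emeasure U {u \<in> space U. F' i (x, u) \<in> A}"
  shows "distr (N \<Otimes>\<^sub>M PiM I (\<lambda>_. U)) (PiM I (\<lambda>_. M)) (\<lambda>(x, u). \<lambda>i\<in>I. F i (x, u i)) =
    distr (N \<Otimes>\<^sub>M PiM I (\<lambda>_. U)) (PiM I (\<lambda>_. M)) (\<lambda>(x, u). \<lambda>i\<in>I. F' i (x, u i))"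
    (is "distr ?\<Omega> ?M (?w F) = distr ?\<Omega> ?M (?w F')")
proof (rule measure_eqI_PiM_infinite)
  interpret N: prob_space N by fact
  interpret U: prob_space U by fact
  interpret P: prob_space "PiM I (\<lambda>_. U)" by (intro prob_space_PiM assms(2))
  interpret NP: pair_prob_space N "PiM I (\<lambda>_. U)" ..
  have w: "?w K \<in> measurable ?\<Omega> ?M" if [measurable]: "\<And>i. i \<in> I \<Longrightarrow> K i \<in> measurable (N \<Otimes>\<^sub>M U) M" for K
    by measurable
  show "finite_measure (distr ?\<Omega> ?M (?w F))"
    using NP.prob_space_distr[OF w[OF F]] by (rule prob_space.finite_measure)
  fix A J assume J: "finite J" "J \<subseteq> I" and A: "\<And>i. i \<in> J \<Longrightarrow> A i \<in> sets M"
  let ?E = "prod_emb I (\<lambda>_. M) J (Pi\<^sub>E J A)"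
  have E: "?E \<in> sets ?M" using J A by (intro sets_PiM_I) auto
  have cyl: "emeasure (distr ?\<Omega> ?M (?w K)) ?E = (\<integral>\<^sup>+x. (\<Prod>i\<in>J. emeasure U {u \<in> space U. K i (x, u) \<in> A i}) \<partial>N)"
    if K [measurable]: "\<And>i. i \<in> I \<Longrightarrow> K i \<in> measurable (N \<Otimes>\<^sub>M U) M" for K
  proof -
    have "emeasure (distr ?\<Omega> ?M (?w K)) ?E = emeasure ?\<Omega> (?w K -` ?E \<inter> space ?\<Omega>)"
      by (rule emeasure_distr[OF w[OF K] E])
    also have "\<dots> = (\<integral>\<^sup>+x. emeasure (PiM I (\<lambda>_. U)) (Pair x -` (?w K -` ?E \<inter> space ?\<Omega>)) \<partial>N)"
      by (rule P.emeasure_pair_measure_alt[OF measurable_sets[OF w[OF K] E]])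
    also have "\<dots> = (\<integral>\<^sup>+x. (\<Prod>i\<in>J. emeasure U {u \<in> space U. K i (x, u) \<in> A i}) \<partial>N)"
    proof (rule nn_integral_cong)
      fix x assume x [measurable]: "x \<in> space N"
      let ?B = "\<lambda>i. {u \<in> space U. K i (x, u) \<in> A i}"
      have Ki: "K i (x, u) \<in> space M" if "i \<in> I" "u \<in> space U" for i u
        using measurable_space[OF K[OF that(1)], of "(x, u)"] x that(2) by (simp add: space_pair_measure)
      have "Pair x -` (?w K -` ?E \<inter> space ?\<Omega>) = prod_emb I (\<lambda>_. U) J (Pi\<^sub>E J ?B)"
        using J(2) x Ki
        by (auto simp: prod_emb_def space_pair_measure space_PiM PiE_iff restrict_def extensional_def subset_eq)
      moreover have "?B i \<in> sets U" if "i \<in> J" for i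
      proof -
        have [measurable]: "K i \<in> measurable (N \<Otimes>\<^sub>M U) M" "A i \<in> sets M" using that J A by auto
        show ?thesis by measurable
      qed
      ultimately show "emeasure (PiM I (\<lambda>_. U)) (Pair x -` (?w K -` ?E \<inter> space ?\<Omega>)) = (\<Prod>i\<in>J. emeasure U (?B i))"
        using J by (simp only:) (rule emeasure_PiM_emb[OF assms(2)], auto)
    qed
    finally show ?thesis .
  qed
  have "AE x in N. \<forall>i\<in>J. emeasure U {u \<in> space U. F i (x, u) \<in> A i} = emeasure U {u \<in> space U. F' i (x, u) \<in> A i}"
    using J A eq by (intro AE_finite_allI) auto
  then have "(\<integral>\<^sup>+x. (\<Prod>i\<in>J. emeasure U {u \<in> space U. F i (x, u) \<in> A i}) \<partial>N) =
      (\<integral>\<^sup>+x. (\<Prod>i\<in>J. emeasure U {u \<in> space U. F' i (x, u) \<in> A i}) \<partial>N)"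
    by (intro nn_integral_cong_AE) (auto elim!: eventually_mono)
  with cyl[of F] cyl[of F'] show "emeasure (distr ?\<Omega> ?M (?w F)) ?E = emeasure (distr ?\<Omega> ?M (?w F')) ?E"
    by simp
qed simp_all

section \<open>The relatively independent extension\<close>

text \<open>Multiplying the argument on the right yields a left action: shifting by
  \<open>g'\<close> and then by \<open>g\<close> evaluates \<open>z\<close> at
  \<open>k \<otimes> g \<otimes> g'\<close>. The outer restriction is the normalisation required by
  \<open>BijGroup\<close>.\<close>

lemma (in group) shift_group_action:
  "group_action G (\<Pi>\<^sub>E k\<in>carrier G. E) (\<lambda>g. \<lambda>z\<in>(\<Pi>\<^sub>E k\<in>carrier G. E). \<lambda>k\<in>carrier G. z (k \<otimes> g))"
proof -
  let ?Z = "\<Pi>\<^sub>E k\<in>carrier G. E"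
  define R where "R g = (\<lambda>z\<in>?Z. \<lambda>k\<in>carrier G. z (k \<otimes> g))" for g
  have app: "R g z = (\<lambda>k\<in>carrier G. z (k \<otimes> g))" if "z \<in> ?Z" for z g
    using that by (simp add: R_def)
  have mem: "R g z \<in> ?Z" if "z \<in> ?Z" "g \<in> carrier G" for z g
    using that by (auto simp: app PiE_iff)
  have mult: "R g (R g' z) = R (g \<otimes> g') z" if "g \<in> carrier G" "g' \<in> carrier G" "z \<in> ?Z" for g g' z
    unfolding app[OF mem[OF that(3,2)]] unfolding app[OF that(3)] using that(1,2)
    by (intro restrict_ext) (simp add: m_assoc)
  have one: "R \<one> z = z" if "z \<in> ?Z" for z
    using that by (auto simp: app PiE_iff extensional_def fun_eq_iff)
  have bij: "R g \<in> Bij ?Z" if g: "g \<in> carrier G" for g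
  proof -
    have "bij_betw (R g) ?Z ?Z"
      using g by (intro bij_betw_byWitness[where f' = "R (inv g)"] ballI image_subsetI mem)
        (simp_all add: mult one)
    then show ?thesis by (simp add: Bij_def R_def)
  qed
  have "R \<in> hom G (BijGroup ?Z)"
  proof (rule homI)
    fix g g' assume g: "g \<in> carrier G" "g' \<in> carrier G"
    have "R (g \<otimes> g') = compose ?Z (R g) (R g')"
    proof
      fix z
      show "R (g \<otimes> g') z = compose ?Z (R g) (R g') z"
        using mult[OF g, of z] by (cases "z \<in> ?Z") (simp_all only: compose_def R_def restrict_apply if_True if_False)
    qed
    then show "R (g \<otimes> g') = R g \<otimes>\<^bsub>BijGroup ?Z\<^esub> R g'"
      using bij g by (simp add: BijGroup_def)
  qed (simp add: BijGroup_def bij)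
  then have "group_action G ?Z R"
    unfolding group_action_def group_hom_def group_hom_axioms_def
    using group_BijGroup is_group by auto
  then show ?thesis by (simp add: R_def[abs_def])
qed

text \<open>The given data with a fixed transfer function for \<open>\<beta>\<close>: by
  \<open>f_law\<close>, \<open>f (x, u)\<close> with a uniform seed \<open>u\<close> samples
  \<open>Y\<close> conditionally on its image under \<open>\<beta>\<close> being
  \<open>x\<close>.\<close>

locale subgroup_extension = group G for G (structure) +
  fixes H :: "'a set" and X :: "'x measure" and T :: "'a \<Rightarrow> 'x \<Rightarrow> 'x"
    and Y :: "'y measure" and S :: "'a \<Rightarrow> 'y \<Rightarrow> 'y" and \<beta> :: "'y \<Rightarrow> 'x" and f :: "'x \<times> real \<Rightarrow> 'y"
  assumes countable_G: "countable (carrier G)" and subH: "subgroup H G"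
    and GX: "G_space G X T" and HY: "G_space (G\<lparr>carrier := H\<rparr>) Y S"
    and factor: "factor_map (G\<lparr>carrier := H\<rparr>) Y S X T \<beta>"
    and f [measurable]: "f \<in> measurable (X \<Otimes>\<^sub>M unif) Y"
    and f_law: "distr (X \<Otimes>\<^sub>M unif) (X \<Otimes>\<^sub>M Y) (\<lambda>(x, u). (x, f (x, u))) = distr Y (X \<Otimes>\<^sub>M Y) (\<lambda>y. (\<beta> y, y))"
begin

sublocale X: prob_space X using GX by (simp add: G_space_def)
sublocale Y: prob_space Y using HY by (simp add: G_space_def)
sublocale U: prob_space unif by (rule prob_space_unif)
sublocale TA: group_action G "space X" T using GX by (simp add: G_space_def)
sublocale SA: group_action "G\<lparr>carrier := H\<rparr>" "space Y" S using HY by (simp add: G_space_def)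

lemma H_G [simp]: "h \<in> H \<Longrightarrow> h \<in> carrier G"
  using subgroup.subset[OF subH] by blast

lemma T_meas [measurable]: "g \<in> carrier G \<Longrightarrow> T g \<in> measurable X X"
  and T_distr: "g \<in> carrier G \<Longrightarrow> distr X X (T g) = X"
  using GX by (auto simp: G_space_def)

lemma S_meas [measurable]: "h \<in> H \<Longrightarrow> S h \<in> measurable Y Y"
  and S_distr: "h \<in> H \<Longrightarrow> distr Y Y (S h) = Y"
  using HY by (auto simp: G_space_def)

lemma \<beta>_meas [measurable]: "\<beta> \<in> measurable Y X"
  and \<beta>_distr: "distr Y X \<beta> = X"
  and \<beta>_equiv: "h \<in> H \<Longrightarrow> AE y in Y. T h (\<beta> y) = \<beta> (S h y)"
  using factor by (auto simp: factor_map_def)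

lemma T_mult: "g \<in> carrier G \<Longrightarrow> g' \<in> carrier G \<Longrightarrow> x \<in> space X \<Longrightarrow> T g (T g' x) = T (g \<otimes> g') x"
  by (simp add: TA.composition_rule)

lemma T_one: "x \<in> space X \<Longrightarrow> T \<one> x = x"
  using TA.id_eq_one by (metis restrict_apply')

lemma S_mult: "g \<in> H \<Longrightarrow> g' \<in> H \<Longrightarrow> y \<in> space Y \<Longrightarrow> S g (S g' y) = S (g \<otimes> g') y"
  using SA.composition_rule[of y g g'] by simp

lemma f_distr: "distr (X \<Otimes>\<^sub>M unif) Y f = Y"
proof -
  have "distr (X \<Otimes>\<^sub>M unif) Y f = distr (distr (X \<Otimes>\<^sub>M unif) (X \<Otimes>\<^sub>M Y) (\<lambda>(x, u). (x, f (x, u)))) Y snd"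
    by (subst distr_distr) (auto intro!: distr_cong simp: comp_def)
  also have "\<dots> = distr Y Y (\<lambda>y. y)"
    unfolding f_law by (subst distr_distr) (auto intro!: distr_cong simp: comp_def)
  finally show ?thesis by simp
qed

text \<open>The equation holds identically for the pairs \<open>(\<beta> y, y)\<close> and concerns
  their joint law alone, so it passes to the pairs \<open>(x, f (x, u))\<close>.\<close>

lemma AE_\<beta>_f: "AE p in X \<Otimes>\<^sub>M unif. \<beta> (f p) = fst p"
proof -
  have "standard_borel X" using GX by (simp add: G_space_def)
  then have "{p \<in> space (X \<Otimes>\<^sub>M Y). \<beta> (snd p) = fst p} \<in> sets (X \<Otimes>\<^sub>M Y)"
    by (rule measurable_eq_standard_borel) measurable
  then have "AE p in distr Y (X \<Otimes>\<^sub>M Y) (\<lambda>y. (\<beta> y, y)). \<beta> (snd p) = fst p"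
    by (subst AE_distr_iff) auto
  then have "AE p in distr (X \<Otimes>\<^sub>M unif) (X \<Otimes>\<^sub>M Y) (\<lambda>(x, u). (x, f (x, u))). \<beta> (snd p) = fst p"
    unfolding f_law .
  then have "AE p in X \<Otimes>\<^sub>M unif. \<beta> (snd ((\<lambda>(x, u). (x, f (x, u))) p)) = fst ((\<lambda>(x, u). (x, f (x, u))) p)"
    by (rule AE_distrD[rotated]) measurable
  then show ?thesis by eventually_elim (auto simp: case_prod_beta)
qed

text \<open>By \<open>fibre_laws_eq\<close> it suffices that \<open>(x, f (T h x, u))\<close> and
  \<open>(x, S h (f (x, u)))\<close> have the same law. Both have the law of
  \<open>(\<beta> y, S h y)\<close>, by invariance of both measures and equivariance of
  \<open>\<beta>\<close>.\<close>

lemma fibre_law_equivariant: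
  assumes h: "h \<in> H" and A: "A \<in> sets Y"
  shows "AE x in X. emeasure unif {u \<in> space unif. f (T h x, u) \<in> A} = emeasure unif {u \<in> space unif. S h (f (x, u)) \<in> A}"
proof -
  have hG [simp]: "h \<in> carrier G" "inv h \<in> carrier G" using h by auto
  note [measurable] = T_meas[OF hG(1)] T_meas[OF hG(2)] S_meas[OF h]
  let ?J = "distr Y (X \<Otimes>\<^sub>M Y) (\<lambda>y. (\<beta> y, y))"
  have inv: "T (inv h) (T h x) = x" if "x \<in> space X" for x
    using that hG by (simp add: T_mult T_one)
  have sp: "T h x \<in> space X" if "x \<in> space X" for x
    using that measurable_space[OF T_meas[OF hG(1)]] by blast
  have "distr X X (T h) \<Otimes>\<^sub>M distr unif unif (\<lambda>u. u) = distr (X \<Otimes>\<^sub>M unif) (X \<Otimes>\<^sub>M unif) (\<lambda>(x, u). (T h x, u))"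
    by (rule pair_measure_distr) (auto simp: U.sigma_finite_measure_axioms)
  then have TU: "distr (X \<Otimes>\<^sub>M unif) (X \<Otimes>\<^sub>M unif) (\<lambda>(x, u). (T h x, u)) = X \<Otimes>\<^sub>M unif"
    by (simp add: T_distr)
  let ?L = "distr (X \<Otimes>\<^sub>M unif) (X \<Otimes>\<^sub>M Y)"
  \<comment> \<open>Writing \<open>x\<close> as \<open>T (inv h) (T h x)\<close> makes the pair a
    function of \<open>(T h x, u)\<close>, which has the same law as \<open>(x, u)\<close>.\<close>
  have "?L (\<lambda>(x, u). (x, f (T h x, u))) = ?L (\<lambda>(x, u). (T (inv h) (T h x), f (T h x, u)))"
    by (rule distr_cong) (auto simp: space_pair_measure inv)
  also have "\<dots> = distr (distr (X \<Otimes>\<^sub>M unif) (X \<Otimes>\<^sub>M unif) (\<lambda>(x, u). (T h x, u))) (X \<Otimes>\<^sub>M Y) (\<lambda>(x, u). (T (inv h) x, f (x, u)))"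
    by (subst distr_distr) (auto intro!: distr_cong simp: comp_def)
  also have "\<dots> = distr (distr (X \<Otimes>\<^sub>M unif) (X \<Otimes>\<^sub>M Y) (\<lambda>(x, u). (x, f (x, u)))) (X \<Otimes>\<^sub>M Y) (\<lambda>(x, y). (T (inv h) x, y))"
    unfolding TU by (subst distr_distr) (auto intro!: distr_cong simp: comp_def)
  also have "\<dots> = distr Y (X \<Otimes>\<^sub>M Y) (\<lambda>y. (T (inv h) (\<beta> y), y))"
    unfolding f_law by (subst distr_distr) (auto intro!: distr_cong simp: comp_def)
  \<comment> \<open>Invariance of \<open>Y\<close> is used backwards, to introduce the
    \<open>S h\<close> that \<open>\<beta>\<close> turns into \<open>T h\<close> and that cancels
    \<open>T (inv h)\<close>.\<close>
  also have "\<dots> = distr (distr Y Y (S h)) (X \<Otimes>\<^sub>M Y) (\<lambda>y. (T (inv h) (\<beta> y), y))"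
    by (simp add: S_distr[OF h])
  also have "\<dots> = distr Y (X \<Otimes>\<^sub>M Y) (\<lambda>y. (T (inv h) (\<beta> (S h y)), S h y))"
    by (subst distr_distr) (auto intro!: distr_cong simp: comp_def)
  also have "\<dots> = distr Y (X \<Otimes>\<^sub>M Y) (\<lambda>y. (\<beta> y, S h y))"
  proof (rule distr_cong_AE[OF refl refl])
    show "AE y in Y. (T (inv h) (\<beta> (S h y)), S h y) = (\<beta> y, S h y)"
      using \<beta>_equiv[OF h] AE_space
    proof eventually_elim
      case (elim y)
      then show ?case using inv[OF measurable_space[OF \<beta>_meas elim(2)]] by simp
    qed
  qed measurable
  also have "\<dots> = distr (distr (X \<Otimes>\<^sub>M unif) (X \<Otimes>\<^sub>M Y) (\<lambda>(x, u). (x, f (x, u)))) (X \<Otimes>\<^sub>M Y) (\<lambda>(x, y). (x, S h y))"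
    unfolding f_law by (subst distr_distr) (auto intro!: distr_cong simp: comp_def)
  also have "\<dots> = ?L (\<lambda>(x, u). (x, S h (f (x, u))))"
    by (subst distr_distr) (auto intro!: distr_cong simp: comp_def)
  finally have eq: "?L (\<lambda>(x, u). (x, f (T h x, u))) = ?L (\<lambda>(x, u). (x, S h (f (x, u))))" .
  have "AE x in X. emeasure unif {u \<in> space unif. (\<lambda>(x, u). f (T h x, u)) (x, u) \<in> A} =
      emeasure unif {u \<in> space unif. (\<lambda>(x, u). S h (f (x, u))) (x, u) \<in> A}"
    by (rule fibre_laws_eq[OF X.prob_space_axioms U.prob_space_axioms _ _ _ A]) (use eq in auto)
  then show ?thesis by simp
qed

section \<open>The random family over \<open>G\<close> and its law\<close>

text \<open>There is one seed per coset rather than per group element, since the action of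
  \<open>H\<close> ties together all values within a coset.\<close>

abbreviation \<Omega> :: "('x \<times> ('a set \<Rightarrow> real)) measure" where
  "\<Omega> \<equiv> X \<Otimes>\<^sub>M PiM (rcosets H) (\<lambda>_. unif)"

definition transversal :: "('a set \<Rightarrow> 'a) \<Rightarrow> bool" where
  "transversal r \<longleftrightarrow> (\<forall>c\<in>rcosets H. r c \<in> c)"

text \<open>
  The point attached to the
  coset \<open>c\<close> is sampled with seed \<open>u c\<close> in the fibre of \<open>\<beta>\<close> over \<open>T (r c) x\<close>, and moved inside \<open>c\<close> by \<open>S\<close>.
\<close>

definition lift :: "('a set \<Rightarrow> 'a) \<Rightarrow> 'x \<times> ('a set \<Rightarrow> real) \<Rightarrow> 'a \<Rightarrow> 'y" where
  "lift r = (\<lambda>(x, u). \<lambda>k\<in>carrier G. S (k \<otimes> inv (r (H #> k))) (f (T (r (H #> k)) x, u (H #> k))))"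

sublocale PU: prob_space "PiM (rcosets H) (\<lambda>_. unif)"
  by (intro prob_space_PiM U.prob_space_axioms)
sublocale \<Omega>: pair_prob_space X "PiM (rcosets H) (\<lambda>_. unif)" ..

lemma coset_mem [simp]: "k \<in> carrier G \<Longrightarrow> H #> k \<in> rcosets H"
  by (simp add: rcosetsI subgroup.subset[OF subH])

lemma coset_diff: "c \<in> rcosets H \<Longrightarrow> a \<in> c \<Longrightarrow> b \<in> c \<Longrightarrow> a \<in> carrier G \<and> a \<otimes> inv b \<in> H"
proof -
  assume "c \<in> rcosets H" "a \<in> c" "b \<in> c"
  then obtain k i j where k: "k \<in> carrier G" and i: "i \<in> H" "a = i \<otimes> k" and j: "j \<in> H" "b = j \<otimes> k"
    by (auto simp: RCOSETS_def r_coset_def)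
  then have "a \<otimes> inv b = i \<otimes> inv j"
    by (simp add: inv_mult_group m_assoc) (simp add: m_assoc[symmetric])
  then show ?thesis
    using i j k subgroup.m_closed[OF subH i(1) subgroup.m_inv_closed[OF subH j(1)]] by simp
qed

lemma transversal_closed: "transversal r \<Longrightarrow> c \<in> rcosets H \<Longrightarrow> r c \<in> carrier G"
  using coset_diff unfolding transversal_def by blast

lemma transversal_diff: "transversal r \<Longrightarrow> k \<in> carrier G \<Longrightarrow> k \<otimes> inv (r (H #> k)) \<in> H"
  using coset_diff[of "H #> k" k "r (H #> k)"] rcos_self[OF _ subH, of k] unfolding transversal_def by simp

lemma coordinate_measurable:
  assumes g [simp]: "g \<in> carrier G" and c: "c \<in> rcosets H"
  shows "(\<lambda>(x, u). (T g x, u c)) \<in> measurable \<Omega> (X \<Otimes>\<^sub>M unif)"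
  using c by measurable

text \<open>This reduces statements about one coordinate of \<open>lift\<close> to statements about
  \<open>f\<close> on the product of \<open>X\<close> and \<open>unif\<close>.\<close>

lemma coordinate_distr:
  assumes g [simp]: "g \<in> carrier G" and c: "c \<in> rcosets H"
  shows "distr \<Omega> (X \<Otimes>\<^sub>M unif) (\<lambda>(x, u). (T g x, u c)) = X \<Otimes>\<^sub>M unif"
proof -
  interpret P: product_prob_space "\<lambda>_. unif" "rcosets H" ..
  have "distr X X (T g) \<Otimes>\<^sub>M distr (PiM (rcosets H) (\<lambda>_. unif)) unif (\<lambda>u. u c) =
      distr \<Omega> (X \<Otimes>\<^sub>M unif) (\<lambda>(x, u). (T g x, u c))"
    using c by (intro pair_measure_distr) (auto simp: P.PiM_component U.sigma_finite_measure_axioms)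
  then show ?thesis using c by (simp add: P.PiM_component T_distr)
qed

lemma lift_measurable:
  assumes r: "transversal r"
  shows "lift r \<in> measurable \<Omega> (PiM (carrier G) (\<lambda>_. Y))"
  unfolding lift_def case_prod_beta
proof (rule measurable_restrict)
  fix k assume k: "k \<in> carrier G"
  show "(\<lambda>p. S (k \<otimes> inv (r (H #> k))) (f (T (r (H #> k)) (fst p), snd p (H #> k)))) \<in> measurable \<Omega> Y"
    using measurable_compose[OF measurable_compose[OF coordinate_measurable[OF transversal_closed[OF r] coset_mem[OF k]] f]
        S_meas[OF transversal_diff[OF r k]]] k
    by (simp add: case_prod_beta)
qed

text \<open>The value at the representative \<open>r c\<close> may be sampled directly
  (\<open>F c\<close>), or sampled at \<open>s c\<close> and moved by
  \<open>r c \<otimes> inv (s c)\<close>, an element of \<open>H\<close> (\<open>F' c\<close>).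
  Equivariance equates the fibre laws for each coset, and conditional independence equates the joint
  laws.\<close>

lemma distr_lift_indep:
  assumes r: "transversal r" and s: "transversal s"
  shows "distr \<Omega> (PiM (carrier G) (\<lambda>_. Y)) (lift r) = distr \<Omega> (PiM (carrier G) (\<lambda>_. Y)) (lift s)"
proof -
  let ?C = "rcosets H" and ?M = "PiM (rcosets H) (\<lambda>_. Y)" and ?P = "PiM (carrier G) (\<lambda>_. Y)"
  define F where "F c = (\<lambda>(x, v). f (T (r c) x, v))" for c
  define F' where "F' c = (\<lambda>(x, v). S (r c \<otimes> inv (s c)) (f (T (s c) x, v)))" for c
  \<comment> \<open>This deterministic map rebuilds the whole family from its values at the
    representatives \<open>r c\<close>; both lifts factor through it.\<close>
  define \<Phi> where "\<Phi> v = (\<lambda>k\<in>carrier G. S (k \<otimes> inv (r (H #> k))) (v (H #> k)))" for v :: "'a set \<Rightarrow> 'y"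
  have rs: "r c \<otimes> inv (s c) \<in> H" "r c \<in> carrier G" "s c \<in> carrier G" if "c \<in> ?C" for c
    using that coset_diff[of c "r c" "s c"] coset_diff[of c "s c" "r c"] r s by (auto simp: transversal_def)
  have F [measurable]: "F c \<in> measurable (X \<Otimes>\<^sub>M unif) Y" if c: "c \<in> ?C" for c
  proof -
    note [measurable] = T_meas[OF rs(2)[OF c]]
    show ?thesis unfolding F_def by measurable
  qed
  have F' [measurable]: "F' c \<in> measurable (X \<Otimes>\<^sub>M unif) Y" if c: "c \<in> ?C" for c
  proof -
    note [measurable] = T_meas[OF rs(3)[OF c]] S_meas[OF rs(1)[OF c]]
    show ?thesis unfolding F'_def by measurable
  qed
  have "distr \<Omega> ?M (\<lambda>(x, u). \<lambda>c\<in>?C. F c (x, u c)) = distr \<Omega> ?M (\<lambda>(x, u). \<lambda>c\<in>?C. F' c (x, u c))"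
  proof (rule distr_conditional_product_eqI[OF X.prob_space_axioms U.prob_space_axioms F F'])
    fix c A assume c: "c \<in> ?C" and A: "A \<in> sets Y"
    \<comment> \<open>Equivariance is needed at the point \<open>T (s c) x\<close>. Since
      \<open>T (s c)\<close> preserves \<open>X\<close>, the almost everywhere statement can be
      pulled back along it.\<close>
    have "AE x in distr X X (T (s c)). emeasure unif {u \<in> space unif. f (T (r c \<otimes> inv (s c)) x, u) \<in> A} =
        emeasure unif {u \<in> space unif. S (r c \<otimes> inv (s c)) (f (x, u)) \<in> A}"
      unfolding T_distr[OF rs(3)[OF c]] by (rule fibre_law_equivariant[OF rs(1)[OF c] A])
    from AE_distrD[OF T_meas[OF rs(3)[OF c]] this] AE_space
    show "AE x in X. emeasure unif {u \<in> space unif. F c (x, u) \<in> A} = emeasure unif {u \<in> space unif. F' c (x, u) \<in> A}"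
    proof eventually_elim
      case (elim x)
      have "T (r c \<otimes> inv (s c)) (T (s c) x) = T (r c) x"
        using rs[OF c] elim(2) by (simp add: T_mult m_assoc)
      with elim(1) show ?case by (simp add: F_def F'_def)
    qed
  qed
  then have "distr (distr \<Omega> ?M (\<lambda>(x, u). \<lambda>c\<in>?C. F c (x, u c))) ?P \<Phi> = distr (distr \<Omega> ?M (\<lambda>(x, u). \<lambda>c\<in>?C. F' c (x, u c))) ?P \<Phi>"
    by simp
  moreover have \<Phi> [measurable]: "\<Phi> \<in> measurable ?M ?P"
    unfolding \<Phi>_def
  proof (rule measurable_restrict)
    fix k assume k: "k \<in> carrier G"
    show "(\<lambda>v. S (k \<otimes> inv (r (H #> k))) (v (H #> k))) \<in> measurable ?M Y"
      by (rule measurable_compose[OF _ S_meas[OF transversal_diff[OF r k]]]) (simp add: k)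
  qed
  moreover have "(\<lambda>(x, u). \<lambda>c\<in>?C. F c (x, u c)) \<in> measurable \<Omega> ?M" "(\<lambda>(x, u). \<lambda>c\<in>?C. F' c (x, u c)) \<in> measurable \<Omega> ?M"
    by measurable
  ultimately have eq: "distr \<Omega> ?P (\<Phi> \<circ> (\<lambda>(x, u). \<lambda>c\<in>?C. F c (x, u c))) = distr \<Omega> ?P (\<Phi> \<circ> (\<lambda>(x, u). \<lambda>c\<in>?C. F' c (x, u c)))"
    by (simp add: distr_distr)
  have "lift r = \<Phi> \<circ> (\<lambda>(x, u). \<lambda>c\<in>?C. F c (x, u c))"
    by (auto simp: lift_def \<Phi>_def F_def fun_eq_iff restrict_def)
  \<comment> \<open>Here the equality is confined to \<open>space \<Omega>\<close>: merging two
    applications of \<open>S\<close> requires the sampled point to lie in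
    \<open>space Y\<close>.\<close>
  moreover have "lift s p = (\<Phi> \<circ> (\<lambda>(x, u). \<lambda>c\<in>?C. F' c (x, u c))) p" if p: "p \<in> space \<Omega>" for p
  proof -
    obtain x u where xu: "p = (x, u)" "x \<in> space X" "\<And>c. c \<in> ?C \<Longrightarrow> u c \<in> space unif"
      using p by (auto simp: space_pair_measure space_PiM)
    have "S (k \<otimes> inv (s (H #> k))) (f (T (s (H #> k)) x, u (H #> k))) =
        S (k \<otimes> inv (r (H #> k))) (F' (H #> k) (x, u (H #> k)))" if k: "k \<in> carrier G" for k
    proof -
      let ?c = "H #> k"
      have c: "?c \<in> ?C" using k by simp
      have "f (T (s ?c) x, u ?c) \<in> space Y"
        using measurable_space[OF f] measurable_space[OF T_meas[OF rs(3)[OF c]] xu(2)] xu(3)[OF c]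
        by (auto simp: space_pair_measure)
      then have "S (k \<otimes> inv (r ?c)) (F' ?c (x, u ?c)) =
          S ((k \<otimes> inv (r ?c)) \<otimes> (r ?c \<otimes> inv (s ?c))) (f (T (s ?c) x, u ?c))"
        unfolding F'_def by (simp add: S_mult[OF transversal_diff[OF r k] rs(1)[OF c]])
      also have "(k \<otimes> inv (r ?c)) \<otimes> (r ?c \<otimes> inv (s ?c)) = k \<otimes> inv (s ?c)"
        using k rs(2,3)[OF c] by (simp add: m_assoc) (simp add: m_assoc[symmetric])
      finally show ?thesis by simp
    qed
    then show ?thesis by (auto simp: xu(1) lift_def \<Phi>_def intro!: restrict_ext)
  qed
  ultimately show ?thesis
    using eq by (simp cong: distr_cong)
qed

text \<open>Pointwise, the shifted family is the lift along another transversal \<open>r'\<close>,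
  evaluated at \<open>T g x\<close> with permuted seeds. The map \<open>?q\<close> making this
  change preserves \<open>\<Omega>\<close>, and replacing \<open>r'\<close> by \<open>r\<close> does
  not affect the law.\<close>

lemma distr_lift_shift:
  assumes r: "transversal r" and g [simp]: "g \<in> carrier G"
  shows "distr (distr \<Omega> (PiM (carrier G) (\<lambda>_. Y)) (lift r)) (PiM (carrier G) (\<lambda>_. Y)) (\<lambda>z. \<lambda>k\<in>carrier G. z (k \<otimes> g)) =
    distr \<Omega> (PiM (carrier G) (\<lambda>_. Y)) (lift r)"
proof -
  let ?C = "rcosets H" and ?P = "PiM (carrier G) (\<lambda>_. Y)" and ?V = "PiM (rcosets H) (\<lambda>_. unif)"
  let ?sh = "\<lambda>z. \<lambda>k\<in>carrier G. z (k \<otimes> g)" and ?t = "\<lambda>u. \<lambda>c\<in>?C. u (c #> g)"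
  \<comment> \<open>The representative of the translated coset is moved back into \<open>c\<close>,
    so that \<open>T (r' c) (T g x)\<close> is \<open>T (r (c #> g)) x\<close>.\<close>
  define r' where "r' c = r (c #> g) \<otimes> inv g" for c
  have shift: "H #> k #> g = H #> (k \<otimes> g)" if "k \<in> carrier G" for k
    using that subgroup.subset[OF subH] by (simp add: coset_mult_assoc)
  have C: "\<exists>k\<in>carrier G. c = H #> k" if "c \<in> ?C" for c using that by (auto simp: RCOSETS_def)
  have Cg: "c #> g \<in> ?C" if "c \<in> ?C" for c
    using C[OF that] shift by (auto simp: coset_mem)
  have inj: "inj_on (\<lambda>c. c #> g) ?C"
  proof (rule inj_onI)
    fix c d assume "c \<in> ?C" "d \<in> ?C" "c #> g = d #> g"
    moreover have "e #> g #> inv g = e" if "e \<in> ?C" for e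
    proof -
      have "e \<subseteq> carrier G" using rcosets_part_G[OF subH] that by auto
      then show ?thesis by (simp add: coset_mult_assoc coset_mult_one)
    qed
    ultimately show "c = d" by metis
  qed
  have r': "transversal r'"
    unfolding transversal_def
  proof
    fix c assume c: "c \<in> ?C"
    then obtain k where k: "k \<in> carrier G" "c = H #> k" using C by blast
    have "r (c #> g) \<in> c #> g" using r Cg[OF c] by (simp add: transversal_def)
    then obtain a where "a \<in> c" "r (c #> g) = a \<otimes> g" by (auto simp: r_coset_def)
    moreover have "a \<in> carrier G" using coset_diff[OF c \<open>a \<in> c\<close> \<open>a \<in> c\<close>] by simp
    ultimately show "r' c \<in> c" by (simp add: r'_def m_assoc)
  qed
  have tm: "?t \<in> measurable ?V ?V"
    by (intro measurable_restrict measurable_component_singleton Cg)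
  \<comment> \<open>Reindexing independent, identically distributed seeds along an injective map of
    cosets keeps their joint law.\<close>
  have td: "distr ?V ?V ?t = ?V"
    using Cg by (intro distr_PiM_reindex[where M = "\<lambda>_. unif"] U.prob_space_axioms inj) auto
  let ?q = "\<lambda>(x, u). (T g x, ?t u)"
  have qm: "?q \<in> measurable \<Omega> \<Omega>"
    using tm by measurable
  have "distr X X (T g) \<Otimes>\<^sub>M distr ?V ?V ?t = distr \<Omega> \<Omega> ?q"
    by (intro pair_measure_distr T_meas g tm) (simp add: td PU.sigma_finite_measure_axioms)
  then have qd: "distr \<Omega> \<Omega> ?q = \<Omega>" by (simp add: td T_distr)
  have shm: "?sh \<in> measurable ?P ?P"
    by (intro measurable_restrict measurable_component_singleton) simp
  have "distr (distr \<Omega> ?P (lift r)) ?P ?sh = distr \<Omega> ?P (?sh \<circ> lift r)"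
    by (rule distr_distr[OF shm lift_measurable[OF r]])
  also have "\<dots> = distr \<Omega> ?P (lift r' \<circ> ?q)"
  proof (rule distr_cong[OF refl refl])
    fix p assume "p \<in> space \<Omega>"
    then obtain x u where xu: "p = (x, u)" "x \<in> space X"
      by (auto simp: space_pair_measure)
    have "S (k \<otimes> g \<otimes> inv (r (H #> (k \<otimes> g)))) (f (T (r (H #> (k \<otimes> g))) x, u (H #> (k \<otimes> g)))) =
        S (k \<otimes> inv (r' (H #> k))) (f (T (r' (H #> k)) (T g x), ?t u (H #> k)))" if k: "k \<in> carrier G" for k
    proof -
      have rc: "r (H #> (k \<otimes> g)) \<in> carrier G" using k by (intro transversal_closed[OF r]) simp
      have "T (r' (H #> k)) (T g x) = T (r (H #> (k \<otimes> g))) x"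
        using k rc xu(2) by (simp add: r'_def shift T_mult m_assoc)
      moreover have "k \<otimes> inv (r' (H #> k)) = k \<otimes> g \<otimes> inv (r (H #> (k \<otimes> g)))"
        using k rc by (simp add: r'_def shift inv_mult_group m_assoc)
      ultimately show ?thesis using k by (simp add: shift)
    qed
    then show "(?sh \<circ> lift r) p = (lift r' \<circ> ?q) p"
      by (auto simp: xu(1) lift_def intro!: restrict_ext)
  qed
  also have "\<dots> = distr (distr \<Omega> \<Omega> ?q) ?P (lift r')"
    by (rule distr_distr[OF lift_measurable[OF r'] qm, symmetric])
  also have "\<dots> = distr \<Omega> ?P (lift r)"
    unfolding qd by (rule distr_lift_indep[OF r' r])
  finally show ?thesis .
qed

text \<open>The representative of the coset of the unit may differ from the unit, so this coordinate
  is a sample over \<open>T (r ?c) x\<close> moved by an element of \<open>H\<close>. Each of the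
  maps composed here carries one law to the next.\<close>

lemma lift_one_distr:
  assumes r: "transversal r"
  shows "distr \<Omega> Y (\<lambda>p. lift r p \<one>) = Y"
proof -
  let ?c = "H #> \<one>"
  have c: "?c \<in> rcosets H" by simp
  note h = transversal_diff[OF r one_closed]
  have "distr \<Omega> Y (\<lambda>p. lift r p \<one>) = distr \<Omega> Y (S (\<one> \<otimes> inv (r ?c)) \<circ> (f \<circ> (\<lambda>(x, u). (T (r ?c) x, u ?c))))"
    by (rule distr_cong) (auto simp: lift_def)
  also have "\<dots> = distr (distr (distr \<Omega> (X \<Otimes>\<^sub>M unif) (\<lambda>(x, u). (T (r ?c) x, u ?c))) Y f) Y (S (\<one> \<otimes> inv (r ?c)))"
    using coordinate_measurable[OF transversal_closed[OF r c] c]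
    by (simp add: distr_distr[OF f] distr_distr[OF S_meas[OF h] measurable_comp[OF _ f]])
  also have "\<dots> = Y"
    by (simp only: coordinate_distr[OF transversal_closed[OF r c] c] f_distr S_distr[OF h])
  finally show ?thesis .
qed

text \<open>Write \<open>k\<close> as \<open>?h \<otimes> r ?c\<close> with \<open>?h\<close> in
  \<open>H\<close>. The sample lies over \<open>T (r ?c) x\<close>, and equivariance of
  \<open>\<beta>\<close> under \<open>?h\<close> moves its image to \<open>T k x\<close>. This is
  the source of the \<open>G\<close>-equivariance of
  \<open>\<beta> \<circ> \<alpha>\<close>.\<close>

lemma AE_\<beta>_lift:
  assumes r: "transversal r" and k: "k \<in> carrier G"
  shows "AE p in \<Omega>. \<beta> (lift r p k) = T k (fst p)"
proof -
  let ?c = "H #> k" and ?h = "k \<otimes> inv (r (H #> k))"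
  have c: "?c \<in> rcosets H" using k by simp
  note h = transversal_diff[OF r k] and rc = transversal_closed[OF r c]
  let ?q = "\<lambda>(x, u). (T (r ?c) x, u ?c)"
  have "AE y in distr (X \<Otimes>\<^sub>M unif) Y f. T ?h (\<beta> y) = \<beta> (S ?h y)"
    unfolding f_distr by (rule \<beta>_equiv[OF h])
  from AE_distrD[OF f this] AE_\<beta>_f have "AE p in X \<Otimes>\<^sub>M unif. \<beta> (S ?h (f p)) = T ?h (fst p)"
    by eventually_elim simp
  then have "AE p in distr \<Omega> (X \<Otimes>\<^sub>M unif) ?q. \<beta> (S ?h (f p)) = T ?h (fst p)"
    unfolding coordinate_distr[OF rc c] .
  from AE_distrD[OF coordinate_measurable[OF rc c] this] AE_space show ?thesis
  proof eventually_elim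
    case (elim p)
    obtain x u where p: "p = (x, u)" "x \<in> space X" using elim(2) by (auto simp: space_pair_measure)
    have "T ?h (T (r ?c) x) = T k x"
      using k rc h p(2) by (simp add: T_mult m_assoc)
    then show ?case using elim(1) k by (simp add: p(1) lift_def)
  qed
qed

text \<open>The unit and \<open>h\<close> lie in the same coset, so both coordinates come from one
  sample and differ only by the action of \<open>H\<close>. The identity therefore holds at every
  point of \<open>\<Omega>\<close>.\<close>

lemma lift_equivariant:
  assumes r: "transversal r" and h: "h \<in> H" and p: "p \<in> space \<Omega>"
  shows "S h (lift r p \<one>) = lift r p h"
proof -
  let ?c = "H #> \<one>"
  have Hh: "H #> h = ?c"
    using h subH by (simp add: coset_mult_one subgroup.subset subgroup.rcos_const[OF _ group_axioms])
  have c: "?c \<in> rcosets H" by simp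
  note rc = transversal_closed[OF r c] and d = transversal_diff[OF r one_closed]
  obtain x u where xu: "p = (x, u)" "x \<in> space X" "u ?c \<in> space unif"
    using p by (auto simp: space_pair_measure space_PiM)
  have y: "f (T (r ?c) x, u ?c) \<in> space Y"
    using measurable_space[OF f] measurable_space[OF T_meas[OF rc] xu(2)] xu(3)
    by (auto simp: space_pair_measure)
  have "S h (S (\<one> \<otimes> inv (r ?c)) (f (T (r ?c) x, u ?c))) = S (h \<otimes> inv (r ?c)) (f (T (r ?c) x, u ?c))"
    using S_mult[OF h d y] rc h by simp
  then show ?thesis using h by (simp add: xu(1) lift_def Hh)
qed

section \<open>Assembly of the extension and its factor maps\<close>

theorem extension_exists:
  "\<exists>(Xt :: ('a \<Rightarrow> 'y) measure) Tt \<pi> \<alpha>.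
     G_space G Xt Tt \<and> factor_map G Xt Tt X T \<pi> \<and>
     factor_map (G\<lparr>carrier := H\<rparr>) Xt Tt Y S \<alpha> \<and> (AE x in Xt. \<pi> x = (\<beta> \<circ> \<alpha>) x)"
proof -
  have "\<exists>k. k \<in> c" if "c \<in> rcosets H" for c
    using that rcos_self[OF _ subH] by (auto simp: RCOSETS_def)
  then have "transversal (\<lambda>c. SOME k. k \<in> c)"
    by (auto simp: transversal_def some_in_eq)
  then obtain r where r: "transversal r" ..
  let ?P = "PiM (carrier G) (\<lambda>_. Y)" and ?Z = "\<Pi>\<^sub>E k\<in>carrier G. space Y"
  let ?sh = "\<lambda>g z. \<lambda>k\<in>carrier G. z (k \<otimes> g)"
  define Xt where "Xt = distr \<Omega> ?P (lift r)"
  define Tt where "Tt g = (\<lambda>z\<in>?Z. ?sh g z)" for g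
  define \<alpha> where "\<alpha> z = z \<one>" for z :: "'a \<Rightarrow> 'y"
  note lift [measurable] = lift_measurable[OF r]
  have sets_Xt [measurable_cong, simp]: "sets Xt = sets ?P" and space_Xt: "space Xt = ?Z"
    by (simp_all add: Xt_def space_PiM)
  have coord [measurable]: "(\<lambda>z. z k) \<in> measurable Xt Y" if "k \<in> carrier G" for k
    using measurable_component_singleton[OF that, of "\<lambda>_. Y"] by (simp cong: measurable_cong_sets)
  \<comment> \<open>Conditions on the new space are checked on sampled families; measurability of
    the condition comes from the standard Borel property of its target.\<close>
  have AE_Xt: "AE z in Xt. Q z" if "AE p in \<Omega>. Q (lift r p)" "{z \<in> space Xt. Q z} \<in> sets Xt" for Q
    using that unfolding Xt_def by (subst AE_distr_iff) auto
  have \<alpha> [measurable]: "\<alpha> \<in> measurable Xt Y" unfolding \<alpha>_def by measurable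
  have sbY: "standard_borel Y" and sbX: "standard_borel X" using GX HY by (auto simp: G_space_def)
  have Tt_eq: "Tt g z = ?sh g z" if "z \<in> space Xt" for g z
    using that by (simp add: Tt_def space_Xt)
  have Tt_meas: "Tt g \<in> measurable Xt Xt" and Tt_distr: "distr Xt Xt (Tt g) = Xt" if g: "g \<in> carrier G" for g
  proof -
    have "?sh g \<in> measurable ?P ?P"
      using g by (intro measurable_restrict measurable_component_singleton) simp
    then have sh: "?sh g \<in> measurable Xt Xt" by (simp cong: measurable_cong_sets)
    then show "Tt g \<in> measurable Xt Xt" using Tt_eq by (simp cong: measurable_cong)
    have "distr Xt Xt (Tt g) = distr Xt ?P (?sh g)"
      by (rule distr_cong) (simp_all add: Tt_eq)
    also have "\<dots> = Xt" unfolding Xt_def by (rule distr_lift_shift[OF r g])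
    finally show "distr Xt Xt (Tt g) = Xt" .
  qed
  have "standard_borel ?P" by (intro standard_borel_PiM countable_G sbY)
  then have sb: "standard_borel Xt" unfolding standard_borel_def by (simp add: Xt_def)
  have act: "group_action G (space Xt) Tt"
    unfolding space_Xt Tt_def by (rule shift_group_action)
  have prob: "prob_space Xt" unfolding Xt_def by (rule \<Omega>.prob_space_distr[OF lift])
  have G: "G_space G Xt Tt"
    using prob sb act Tt_meas Tt_distr by (simp add: G_space_def)
  have GH: "G_space (G\<lparr>carrier := H\<rparr>) Xt Tt"
  proof -
    have "group_hom (G\<lparr>carrier := H\<rparr>) (BijGroup (space Xt)) Tt"
      using act subgroup.subgroup_is_group[OF subH is_group]
      by (auto simp: group_action_def group_hom_def group_hom_axioms_def hom_def)
    then show ?thesis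
      using prob sb Tt_meas Tt_distr by (simp add: G_space_def group_action_def)
  qed
  have \<alpha>_distr: "distr Xt Y \<alpha> = Y"
    unfolding Xt_def
    by (subst distr_distr) (use \<alpha> lift_one_distr[OF r] in \<open>auto simp: \<alpha>_def comp_def cong: measurable_cong_sets\<close>)
  have "AE z in Xt. S h (\<alpha> z) = \<alpha> (Tt h z)" if h: "h \<in> H" for h
  proof (rule AE_Xt)
    note [measurable] = S_meas[OF h] Tt_meas[OF H_G[OF h]]
    show "{z \<in> space Xt. S h (\<alpha> z) = \<alpha> (Tt h z)} \<in> sets Xt"
      by (rule measurable_eq_standard_borel[OF sbY]) measurable
    show "AE p in \<Omega>. S h (\<alpha> (lift r p)) = \<alpha> (Tt h (lift r p))"
      using measurable_space[OF lift] h lift_equivariant[OF r h]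
      by (intro AE_I2) (simp add: \<alpha>_def Tt_eq Xt_def)
  qed
  then have fac_\<alpha>: "factor_map (G\<lparr>carrier := H\<rparr>) Xt Tt Y S \<alpha>"
    using GH HY \<alpha> \<alpha>_distr by (simp add: factor_map_def)
  have "distr Xt X (\<beta> \<circ> \<alpha>) = X"
    using distr_distr[OF \<beta>_meas \<alpha>] by (simp add: \<alpha>_distr \<beta>_distr)
  moreover have "AE z in Xt. T g ((\<beta> \<circ> \<alpha>) z) = (\<beta> \<circ> \<alpha>) (Tt g z)" if g: "g \<in> carrier G" for g
  proof (rule AE_Xt)
    note [measurable] = T_meas[OF g] Tt_meas[OF g]
    show "{z \<in> space Xt. T g ((\<beta> \<circ> \<alpha>) z) = (\<beta> \<circ> \<alpha>) (Tt g z)} \<in> sets Xt"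
      unfolding comp_def by (rule measurable_eq_standard_borel[OF sbX]) measurable
    \<comment> \<open>Evaluating the shifted family at the unit gives its coordinate
      \<open>g\<close>. By \<open>AE_\<beta>_lift\<close> at the unit and at \<open>g\<close>, both
      sides equal \<open>T g (fst p)\<close>.\<close>
    show "AE p in \<Omega>. T g ((\<beta> \<circ> \<alpha>) (lift r p)) = (\<beta> \<circ> \<alpha>) (Tt g (lift r p))"
      using AE_\<beta>_lift[OF r one_closed] AE_\<beta>_lift[OF r g] AE_space
    proof eventually_elim
      case (elim p)
      then have "fst p \<in> space X" "lift r p \<in> space Xt"
        using measurable_space[OF lift elim(3)] by (auto simp: Xt_def space_pair_measure)
      then show ?case using elim g by (simp add: \<alpha>_def Tt_eq T_one)
    qed
  qed
  ultimately have "factor_map G Xt Tt X T (\<beta> \<circ> \<alpha>)"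
    using G GX measurable_comp[OF \<alpha> \<beta>_meas] by (simp add: factor_map_def)
  with G fac_\<alpha> show ?thesis
    by (intro exI[of _ Xt] exI[of _ Tt] exI[of _ "\<beta> \<circ> \<alpha>"] exI[of _ \<alpha>]) simp
qed

end

theorem theorem2p1:
  fixes G :: "('g, 'm) monoid_scheme" and H :: "'g set"
    and X :: "'x measure" and T :: "'g \<Rightarrow> 'x \<Rightarrow> 'x"
    and Y :: "'y measure" and S :: "'g \<Rightarrow> 'y \<Rightarrow> 'y"
    and \<beta> :: "'y \<Rightarrow> 'x"
  assumes "group G" and "countable (carrier G)" and "subgroup H G"
    and "G_space G X T"
    and "G_space (G\<lparr>carrier := H\<rparr>) Y S"
    and "factor_map (G\<lparr>carrier := H\<rparr>) Y S X T \<beta>"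
  shows "\<exists>(Xt :: ('g \<Rightarrow> 'y) measure) Tt \<pi> \<alpha>.
           G_space G Xt Tt \<and>
           factor_map G Xt Tt X T \<pi> \<and>
           factor_map (G\<lparr>carrier := H\<rparr>) Xt Tt Y S \<alpha> \<and>
           (AE x in Xt. \<pi> x = (\<beta> \<circ> \<alpha>) x)"
proof -
  have "prob_space Y" "standard_borel Y" "\<beta> \<in> measurable Y X" "distr Y X \<beta> = X"
    using assms(5,6) by (simp_all add: G_space_def factor_map_def)
  then obtain f where "f \<in> measurable (X \<Otimes>\<^sub>M unif) Y"
    "distr (X \<Otimes>\<^sub>M unif) (X \<Otimes>\<^sub>M Y) (\<lambda>(x, u). (x, f (x, u))) = distr Y (X \<Otimes>\<^sub>M Y) (\<lambda>y. (\<beta> y, y))"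
    using transfer_function_standard_borel by blast
  then have "subgroup_extension G H X T Y S \<beta> f"
    using assms by (simp add: subgroup_extension_def subgroup_extension_axioms_def)
  then show ?thesis by (rule subgroup_extension.extension_exists)
qed

end
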